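(* Assume $\lambda_1(-L)\in\sigma_{disc}(-L)$, and that there exists $\kappa>0$ such that the function $W=\frac{V''}{2}+\frac{(V')^2}{4}$ satisfies $W''(x)\ge2\kappa^2$ for all $x\in\mathbb R$. Then $$\lambda_2(-L)-\lambda_1(-L)\ \ge\ 2\kappa .$$
   Context: $V\in C^\infty(\mathbb R)$ with $\int e^{-V}dx<\infty$, $\mu$ the probability measure with density proportional to $e^{-V}$, $Lf=f''-V'f'$ self-adjoint in $L^2(\mu)$ (unique extension from $C_0^\infty(\mathbb R)$). $\sigma_{disc}(-L)$ is the set of isolated eigenvalues of finite multiplicity. For $n\ge1$, $\lambda_n(-L)=\sup_{g_0,\dots,g_{n-1}\in L^2(\mu)}\inf_{f\in D(-L)\setminus\{0\},\,f\perp_\mu g_i}\frac{\int f(-Lf)\,d\mu}{\int f^2d\mu}$ (max-min values; $\lambda_1(-L)$ is the spectral gap, and $\lambda_2(-L)$ may be the bottom of the essential spectrum). *)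

theory Defs
  imports "HOL-Analysis.Analysis"
begin

definition smooth :: "(real \<Rightarrow> real) \<Rightarrow> bool" where
  "smooth f \<longleftrightarrow> (\<forall>n x. ((deriv ^^ n) f) differentiable (at x))"

definition test_fun :: "(real \<Rightarrow> real) \<Rightarrow> bool" where
  "test_fun \<phi> \<longleftrightarrow> smooth \<phi> \<and> (\<exists>R. \<forall>x. \<bar>x\<bar> > R \<longrightarrow> \<phi> x = 0)"

definition Zc :: "(real \<Rightarrow> real) \<Rightarrow> real" where
  "Zc V = (LINT x|lborel. exp (- V x))"

definition mu :: "(real \<Rightarrow> real) \<Rightarrow> real measure" where
  "mu V = density lborel (\<lambda>x. ennreal (exp (- V x) / Zc V))"

text \<open>Membership in L2(mu) (functions taken modulo a.e. equality implicitly).\<close>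
definition L2 :: "(real \<Rightarrow> real) \<Rightarrow> (real \<Rightarrow> real) \<Rightarrow> bool" where
  "L2 V f \<longleftrightarrow> f \<in> borel_measurable borel \<and> integrable (mu V) (\<lambda>x. (f x)\<^sup>2)"

definition Lop :: "(real \<Rightarrow> real) \<Rightarrow> (real \<Rightarrow> real) \<Rightarrow> real \<Rightarrow> real" where
  "Lop V f x = deriv (deriv f) x - deriv V x * deriv f x"

text \<open>Graph of the closure of -L defined on test functions in L2(mu), i.e. of the
  (unique) self-adjoint extension: graph V f g means f \<in> D(-L) and -L f = g.\<close>
definition graph :: "(real \<Rightarrow> real) \<Rightarrow> (real \<Rightarrow> real) \<Rightarrow> (real \<Rightarrow> real) \<Rightarrow> bool" where
  "graph V f g \<longleftrightarrow> L2 V f \<and> L2 V g \<and>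
     (\<exists>\<phi> :: nat \<Rightarrow> real \<Rightarrow> real. (\<forall>n. test_fun (\<phi> n)) \<and>
        (\<lambda>n. LINT x|mu V. (\<phi> n x - f x)\<^sup>2) \<longlonglongrightarrow> 0 \<and>
        (\<lambda>n. LINT x|mu V. (- Lop V (\<phi> n) x - g x)\<^sup>2) \<longlonglongrightarrow> 0)"

text \<open>Max-min values lambda_n(-L), n = number of orthogonality constraints.\<close>
definition lam :: "(real \<Rightarrow> real) \<Rightarrow> nat \<Rightarrow> ereal" where
  "lam V n = (SUP gs \<in> {gs :: nat \<Rightarrow> real \<Rightarrow> real. \<forall>i<n. L2 V (gs i)}.
      INF fg \<in> {(f, g). graph V f g \<and> (LINT x|mu V. (f x)\<^sup>2) > 0 \<and>
                       (\<forall>i<n. (LINT x|mu V. f x * gs i x) = 0)}.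
        ereal ((LINT x|mu V. fst fg x * snd fg x) / (LINT x|mu V. (fst fg x)\<^sup>2)))"

text \<open>Spectrum of the (closed) operator -L: l is in the resolvent set iff -L - l
  is a bijection from D(-L) onto L2(mu) (modulo a.e. equality).\<close>
definition spectrum_L :: "(real \<Rightarrow> real) \<Rightarrow> real set" where
  "spectrum_L V = {l. \<not> ((\<forall>f g. graph V f g \<and> (AE x in mu V. g x = l * f x)
                                 \<longrightarrow> (AE x in mu V. f x = 0)) \<and>
                       (\<forall>h. L2 V h \<longrightarrow> (\<exists>f g. graph V f g \<and>
                                 (AE x in mu V. g x - l * f x = h x))))}"

definition eigfun :: "(real \<Rightarrow> real) \<Rightarrow> real \<Rightarrow> (real \<Rightarrow> real) \<Rightarrow> bool" where
  "eigfun V l f \<longleftrightarrow> (\<exists>g. graph V f g \<and> (AE x in mu V. g x = l * f x))"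

definition sigma_disc :: "(real \<Rightarrow> real) \<Rightarrow> real set" where
  "sigma_disc V = {l. l \<in> spectrum_L V \<and>
      (\<exists>e>0. \<forall>m \<in> spectrum_L V. \<bar>m - l\<bar> < e \<longrightarrow> m = l) \<and>
      (\<exists>f. eigfun V l f \<and> (LINT x|mu V. (f x)\<^sup>2) > 0) \<and>
      (\<exists>k (b :: nat \<Rightarrow> real \<Rightarrow> real). \<forall>f. eigfun V l f \<longrightarrow>
          (\<exists>c :: nat \<Rightarrow> real. AE x in mu V. f x = (\<Sum>i<k. c i * b i x)))}"

end

theory Submission
  imports Defs "HOL-Probability.Distribution_Functions"
begin

text \<open>
  With \<open>\<rho>\<close> the density of \<open>\<mu>\<close>, the nonzero part of the spectrum of \<open>-L\<close> is that of its
  supersymmetric partner \<open>H = -d\<^sup>2/dx\<^sup>2 + W\<close>: a mean-zero test function \<open>\<phi>\<close> corresponds to the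
  compactly supported \<open>v = \<rho>\<^bsup>-1/2\<^esup> \<integral> \<phi> \<rho>\<close>, for which
  \<open>\<integral> \<phi>\<^sup>2 d\<mu> = \<integral> v'\<^sup>2 + W v\<^sup>2\<close>. If \<open>F\<close> is an eigenfunction for
  \<open>\<lambda>\<^sub>1\<close>, then \<open>u = \<rho>\<^bsup>1/2\<^esup> F'\<close> solves \<open>H u = \<lambda>\<^sub>1 u\<close>, and minimality of
  \<open>\<lambda>\<^sub>1\<close> forces \<open>u\<close> to have no zeros. Its logarithmic derivative \<open>-p\<close> satisfies
  \<open>p' = p\<^sup>2 - W + \<lambda>\<^sub>1\<close>, and strong convexity of \<open>W\<close> gives \<open>p' \<ge> \<kappa>\<close>. Passing to the partner
  a second time, now with respect to \<open>u\<^sup>2 dx\<close>, adds the potential \<open>2 p' \<ge> 2 \<kappa>\<close>, which bounds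
  \<open>H - \<lambda>\<^sub>1\<close> below by \<open>2 \<kappa>\<close> on the orthogonal complement of \<open>u\<close>.
\<close>

section \<open>Continuously differentiable functions of compact support\<close>

definition C0_compact :: "(real \<Rightarrow> real) \<Rightarrow> bool" where
  "C0_compact f \<longleftrightarrow> continuous_on UNIV f \<and> (\<exists>R. \<forall>x. \<bar>x\<bar> > R \<longrightarrow> f x = 0)"

definition C1_compact :: "(real \<Rightarrow> real) \<Rightarrow> (real \<Rightarrow> real) \<Rightarrow> bool" where
  "C1_compact f f' \<longleftrightarrow> (\<forall>x. (f has_real_derivative f' x) (at x)) \<and> continuous_on UNIV f' \<and>
     (\<exists>R. \<forall>x. \<bar>x\<bar> > R \<longrightarrow> f x = 0)"

lemma DERIV_continuous_on_UNIV:
  assumes "\<And>x. ((f :: real \<Rightarrow> real) has_real_derivative f' x) (at x)"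
  shows "continuous_on UNIV f"
  using assms by (meson DERIV_isCont continuous_at_imp_continuous_on)

lemma DERIV_eq_0_if_constant_on_open:
  fixes f :: "real \<Rightarrow> real"
  assumes "(f has_real_derivative d) (at x)" "open S" "x \<in> S" "\<And>y. y \<in> S \<Longrightarrow> f y = c"
  shows "d = 0"
proof -
  have "(f has_real_derivative 0) (at x)"
    using assms(2-4) by (intro has_field_derivative_transform_within_open[OF DERIV_const]) auto
  thus ?thesis using assms(1) DERIV_unique by blast
qed

lemma C0_compact_continuous: "C0_compact f \<Longrightarrow> continuous_on UNIV f"
  by (simp add: C0_compact_def)

lemma C0_compact_measurable: "C0_compact f \<Longrightarrow> f \<in> borel_measurable borel"
  by (simp add: C0_compact_def borel_measurable_continuous_onI)

lemma C0_compact_mult_left: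
  assumes "C0_compact f" "continuous_on UNIV g"
  shows "C0_compact (\<lambda>x. g x * f x)"
  using assms unfolding C0_compact_def by (auto intro!: continuous_intros)

lemma C0_compact_mult_right:
  assumes "C0_compact f" "continuous_on UNIV g"
  shows "C0_compact (\<lambda>x. f x * g x)"
  using C0_compact_mult_left[OF assms] by (simp add: mult.commute)

lemma C0_compact_add:
  assumes "C0_compact f" "C0_compact g"
  shows "C0_compact (\<lambda>x. f x + g x)"
proof -
  obtain R S where "\<forall>x. \<bar>x\<bar> > R \<longrightarrow> f x = 0" "\<forall>x. \<bar>x\<bar> > S \<longrightarrow> g x = 0"
    using assms unfolding C0_compact_def by blast
  hence "\<forall>x. \<bar>x\<bar> > max R S \<longrightarrow> f x + g x = 0" by auto
  moreover have "continuous_on UNIV (\<lambda>x. f x + g x)"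
    using assms by (intro continuous_intros C0_compact_continuous)
  ultimately show ?thesis unfolding C0_compact_def by blast
qed

lemma C0_compact_diff:
  assumes "C0_compact f" "C0_compact g"
  shows "C0_compact (\<lambda>x. f x - g x)"
  using C0_compact_add[OF assms(1) C0_compact_mult_left[OF assms(2), of "\<lambda>_. -1"]] by simp

lemma C0_compact_power2: "C0_compact f \<Longrightarrow> C0_compact (\<lambda>x. (f x)\<^sup>2)"
  by (simp add: power2_eq_square C0_compact_mult_left C0_compact_continuous)

lemma C0_compact_bounded:
  assumes "C0_compact f"
  obtains C where "\<And>x. \<bar>f x\<bar> \<le> C"
proof -
  obtain R where support: "\<And>x. \<bar>x\<bar> > R \<Longrightarrow> f x = 0" using assms unfolding C0_compact_def by blast
  have "compact (f ` {-R..R})"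
    using continuous_on_subset[OF C0_compact_continuous[OF assms]]
    by (intro compact_continuous_image) auto
  then obtain C where C: "C > 0" "\<And>x. x \<in> {-R..R} \<Longrightarrow> \<bar>f x\<bar> \<le> C"
    by (auto dest!: compact_imp_bounded simp: bounded_pos)
  have "\<bar>f x\<bar> \<le> C" for x
    using C(1) C(2)[of x] support[of x] by (cases "x \<in> {-R..R}") auto
  thus ?thesis by (rule that)
qed

lemma C0_compact_integrable:
  assumes "C0_compact f"
  shows "integrable lborel f"
proof -
  obtain R where support: "\<And>x. \<bar>x\<bar> > R \<Longrightarrow> f x = 0" using assms unfolding C0_compact_def by blast
  have "integrable lborel (\<lambda>x. indicator {-R..R} x *\<^sub>R f x)"
    using continuous_on_subset[OF C0_compact_continuous[OF assms]]
    by (intro borel_integrable_compact) auto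
  moreover have "(\<lambda>x. indicator {-R..R} x *\<^sub>R f x) = f"
    using support by (force simp: fun_eq_iff split: split_indicator)
  ultimately show ?thesis by simp
qed

lemma C1_compact_DERIV: "C1_compact f f' \<Longrightarrow> (f has_real_derivative f' x) (at x)"
  by (simp add: C1_compact_def)

lemma C1_compact_C0: "C1_compact f f' \<Longrightarrow> C0_compact f"
  unfolding C1_compact_def C0_compact_def by (metis DERIV_continuous_on_UNIV)

lemma C1_compact_C0_deriv:
  assumes "C1_compact f f'"
  shows "C0_compact f'"
proof -
  obtain R where support: "\<And>x. \<bar>x\<bar> > R \<Longrightarrow> f x = 0" using assms unfolding C1_compact_def by blast
  have "open {x :: real. \<bar>x\<bar> > R}" by (intro open_Collect_less continuous_intros)
  hence "f' x = 0" if "\<bar>x\<bar> > R" for x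
    using DERIV_eq_0_if_constant_on_open[OF C1_compact_DERIV[OF assms], of "{x. \<bar>x\<bar> > R}" x 0]
      support that
    by simp
  thus ?thesis using assms unfolding C0_compact_def C1_compact_def by blast
qed

lemma C1_compact_mult:
  assumes f: "C1_compact f f'"
    and g: "\<And>x. (g has_real_derivative g' x) (at x)" "continuous_on UNIV g'"
  shows "C1_compact (\<lambda>x. g x * f x) (\<lambda>x. g' x * f x + g x * f' x)"
proof -
  have "continuous_on UNIV f'" "continuous_on UNIV g" "continuous_on UNIV f"
    using f g C1_compact_C0[OF f]
    by (auto simp: C1_compact_def C0_compact_def intro: DERIV_continuous_on_UNIV)
  thus ?thesis using assms unfolding C1_compact_def
    by (auto intro!: continuous_intros derivative_eq_intros)
qed

lemma continuous_antiderivative: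
  fixes f :: "real \<Rightarrow> real"
  assumes "continuous_on UNIV f"
  obtains F where "\<And>x. (F has_real_derivative f x) (at x)" "F a = c"
proof -
  obtain G where G: "\<And>x. (G has_real_derivative f x) (at x)"
    using einterval_antiderivative[of "-\<infinity>" "\<infinity>" f] assms
    by (auto simp: has_real_derivative_iff_has_vector_derivative continuous_on_eq_continuous_at)
  show ?thesis
    by (rule that[of "\<lambda>x. G x - G a + c"]) (auto intro!: derivative_eq_intros G)
qed

lemma LINT_Icc_deriv:
  fixes F f :: "real \<Rightarrow> real"
  assumes "a \<le> b" "\<And>x. (F has_real_derivative f x) (at x)" "continuous_on UNIV f"
  shows "(LINT x:{a..b}|lborel. f x) = F b - F a"
  using integral_FTC_Icc_real[of a b F f] assms continuous_on_eq_continuous_at[of UNIV f]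
  by (auto simp: set_lebesgue_integral_def mult.commute
      has_real_derivative_iff_has_vector_derivative[symmetric])

lemma C1_compact_common_support:
  assumes "C1_compact F f"
  obtains S where "S > \<bar>a\<bar>" "\<And>x. \<bar>x\<bar> \<ge> S \<Longrightarrow> F x = 0" "\<And>x. \<bar>x\<bar> \<ge> S \<Longrightarrow> f x = 0"
proof -
  obtain R R' where "\<forall>x. \<bar>x\<bar> > R \<longrightarrow> F x = 0" "\<forall>x. \<bar>x\<bar> > R' \<longrightarrow> f x = 0"
    using C1_compact_C0[OF assms] C1_compact_C0_deriv[OF assms] unfolding C0_compact_def by blast
  thus ?thesis by (intro that[of "\<bar>R\<bar> + \<bar>R'\<bar> + \<bar>a\<bar> + 1"]) auto
qed

lemma LINT_atMost_deriv_compact: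
  assumes "C1_compact F f"
  shows "(LINT x:{..a}|lborel. f x) = F a"
proof -
  obtain S where S: "S > \<bar>a\<bar>" "\<And>x. \<bar>x\<bar> \<ge> S \<Longrightarrow> F x = 0" "\<And>x. \<bar>x\<bar> \<ge> S \<Longrightarrow> f x = 0"
    using C1_compact_common_support[OF assms] by blast
  have "(LINT x:{..a}|lborel. f x) = (LINT x:{-S..a}|lborel. f x)"
    unfolding set_lebesgue_integral_def
    using S(1,3) by (intro Bochner_Integration.integral_cong) (auto split: split_indicator)
  also have "\<dots> = F a - F (-S)"
    using S(1) assms by (intro LINT_Icc_deriv) (auto simp: C1_compact_def)
  finally show ?thesis using S by simp
qed

lemma LINT_atLeast_deriv_compact:
  assumes "C1_compact F f"
  shows "(LINT x:{a..}|lborel. f x) = - F a"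
proof -
  obtain S where S: "S > \<bar>a\<bar>" "\<And>x. \<bar>x\<bar> \<ge> S \<Longrightarrow> F x = 0" "\<And>x. \<bar>x\<bar> \<ge> S \<Longrightarrow> f x = 0"
    using C1_compact_common_support[OF assms] by blast
  have "(LINT x:{a..}|lborel. f x) = (LINT x:{a..S}|lborel. f x)"
    unfolding set_lebesgue_integral_def
    using S(1,3) by (intro Bochner_Integration.integral_cong) (auto split: split_indicator)
  also have "\<dots> = F S - F a"
    using S(1) assms by (intro LINT_Icc_deriv) (auto simp: C1_compact_def)
  finally show ?thesis using S by simp
qed

lemma LINT_deriv_compact:
  assumes "C1_compact F f"
  shows "(LINT x|lborel. f x) = 0"
proof -
  obtain S where S: "S > \<bar>0\<bar>" "\<And>x. \<bar>x\<bar> \<ge> S \<Longrightarrow> F x = 0" "\<And>x. \<bar>x\<bar> \<ge> S \<Longrightarrow> f x = 0"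
    using C1_compact_common_support[OF assms] by blast
  have "(LINT x|lborel. f x) = (LINT x:{..S}|lborel. f x)"
    unfolding set_lebesgue_integral_def
    using S(3) by (intro Bochner_Integration.integral_cong) (auto split: split_indicator)
  thus ?thesis using LINT_atMost_deriv_compact[OF assms] S by simp
qed

lemma C1_compact_antiderivative:
  assumes g: "C0_compact g" and mean: "(LINT x|lborel. g x) = 0"
  obtains F where "C1_compact F g"
proof -
  obtain R where R: "\<And>x. \<bar>x\<bar> > R \<Longrightarrow> g x = 0" using g unfolding C0_compact_def by blast
  define S where "S = \<bar>R\<bar> + 1"
  obtain F where F: "\<And>x. (F has_real_derivative g x) (at x)" "F (-S) = 0"
    using continuous_antiderivative[OF C0_compact_continuous[OF g]] by blast
  note increment = LINT_Icc_deriv[OF _ F(1) C0_compact_continuous[OF g]]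
  have right: "F x = 0" if "x > S" for x
  proof -
    have "(LINT y:{-S..x}|lborel. g y) = (LINT y|lborel. g y)"
      unfolding set_lebesgue_integral_def
      using R that
      by (intro Bochner_Integration.integral_cong) (auto simp: S_def split: split_indicator)
    thus ?thesis using increment[of "-S" x] that F(2) mean by (simp add: S_def)
  qed
  have left: "F x = 0" if "x < -S" for x
  proof -
    have "(LINT y:{x..-S}|lborel. g y) = (LINT y:{x..-S}|lborel. 0)"
      unfolding set_lebesgue_integral_def
      using R by (intro Bochner_Integration.integral_cong) (auto simp: S_def split: split_indicator)
    thus ?thesis using increment[of x "-S"] that F(2) by simp
  qed
  have "F x = 0" if "\<bar>x\<bar> > S" for x using left[of x] right[of x] that by linarith
  hence "C1_compact F g" using F(1) C0_compact_continuous[OF g] unfolding C1_compact_def by blast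
  thus ?thesis by (rule that)
qed

section \<open>Square-integrable functions\<close>

definition square_integrable :: "'a measure \<Rightarrow> ('a \<Rightarrow> real) \<Rightarrow> bool" where
  "square_integrable M f \<longleftrightarrow> f \<in> borel_measurable M \<and> integrable M (\<lambda>x. (f x)\<^sup>2)"

definition L2_tendsto :: "'a measure \<Rightarrow> (nat \<Rightarrow> 'a \<Rightarrow> real) \<Rightarrow> ('a \<Rightarrow> real) \<Rightarrow> bool" where
  "L2_tendsto M \<phi> f \<longleftrightarrow> (\<forall>n. square_integrable M (\<phi> n)) \<and> square_integrable M f \<and>
     (\<lambda>n. LINT x|M. (\<phi> n x - f x)\<^sup>2) \<longlonglongrightarrow> 0"

lemma square_integrable_measurable[measurable_dest]:
  "square_integrable M f \<Longrightarrow> f \<in> borel_measurable M"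
  by (simp add: square_integrable_def)

lemma square_integrable_power2: "square_integrable M f \<Longrightarrow> integrable M (\<lambda>x. (f x)\<^sup>2)"
  by (simp add: square_integrable_def)

lemma square_integrable_mult:
  assumes "square_integrable M f" "square_integrable M g"
  shows "integrable M (\<lambda>x. f x * g x)"
proof (rule Bochner_Integration.integrable_bound)
  note [measurable] = assms[THEN square_integrable_measurable]
  show "integrable M (\<lambda>x. (f x)\<^sup>2 + (g x)\<^sup>2)"
    using assms by (intro Bochner_Integration.integrable_add square_integrable_power2)
  show "(\<lambda>x. f x * g x) \<in> borel_measurable M" by measurable
  have "\<bar>a * b\<bar> \<le> a\<^sup>2 + b\<^sup>2" for a b :: real
    using sum_squares_bound[of a b] sum_squares_bound[of a "-b"] by (auto simp: abs_if)
  thus "AE x in M. norm (f x * g x) \<le> norm ((f x)\<^sup>2 + (g x)\<^sup>2)" by simp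
qed

lemma
  assumes "square_integrable M f" "square_integrable M g"
  shows square_integrable_lincomb: "square_integrable M (\<lambda>x. a * f x + b * g x)"
    and LINT_lincomb_power2: "(LINT x|M. (a * f x + b * g x)\<^sup>2) =
      a\<^sup>2 * (LINT x|M. (f x)\<^sup>2) + 2 * a * b * (LINT x|M. f x * g x) + b\<^sup>2 * (LINT x|M. (g x)\<^sup>2)"
proof -
  note [measurable] = assms[THEN square_integrable_measurable]
  note integrable = assms[THEN square_integrable_power2] square_integrable_mult[OF assms]
  have expand: "(a * f x + b * g x)\<^sup>2 = a\<^sup>2 * (f x)\<^sup>2 + 2 * a * b * (f x * g x) + b\<^sup>2 * (g x)\<^sup>2"
    for x
    by (simp add: power2_eq_square algebra_simps)
  show "square_integrable M (\<lambda>x. a * f x + b * g x)"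
    unfolding square_integrable_def expand using integrable by simp
  show "(LINT x|M. (a * f x + b * g x)\<^sup>2) =
      a\<^sup>2 * (LINT x|M. (f x)\<^sup>2) + 2 * a * b * (LINT x|M. f x * g x) + b\<^sup>2 * (LINT x|M. (g x)\<^sup>2)"
    unfolding expand using integrable by simp
qed

lemma square_integrable_diff:
  "square_integrable M f \<Longrightarrow> square_integrable M g \<Longrightarrow> square_integrable M (\<lambda>x. f x - g x)"
  using square_integrable_lincomb[of M f g 1 "-1"] by simp

lemma square_integrable_add:
  "square_integrable M f \<Longrightarrow> square_integrable M g \<Longrightarrow> square_integrable M (\<lambda>x. f x + g x)"
  using square_integrable_lincomb[of M f g 1 1] by simp

lemma square_integrable_cmult:
  "square_integrable M f \<Longrightarrow> square_integrable M (\<lambda>x. c * f x)"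
  using square_integrable_lincomb[of M f f c 0] by simp

lemma square_integrable_bound:
  assumes "square_integrable M g" and [measurable]: "f \<in> borel_measurable M" and "\<And>x. \<bar>f x\<bar> \<le> \<bar>g x\<bar>"
  shows "square_integrable M f"
  unfolding square_integrable_def
proof
  show "integrable M (\<lambda>x. (f x)\<^sup>2)"
    using square_integrable_power2[OF assms(1)]
    by (rule Bochner_Integration.integrable_bound) (use assms(3) in \<open>auto simp: abs_le_square_iff\<close>)
qed (rule assms(2))

lemma square_integrable_abs: "square_integrable M f \<Longrightarrow> square_integrable M (\<lambda>x. \<bar>f x\<bar>)"
  by (rule square_integrable_bound[of M f]) (auto dest: square_integrable_measurable)

lemma square_integrable_indicator_mult:
  assumes "square_integrable M f" "S \<in> sets M"
  shows "square_integrable M (\<lambda>x. indicator S x * f x)"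
  by (rule square_integrable_bound[OF assms(1)])
    (use assms in \<open>auto split: split_indicator dest: square_integrable_measurable\<close>)

lemma (in finite_measure) square_integrable_const: "square_integrable M (\<lambda>_. c)"
  by (simp add: square_integrable_def)

lemma (in finite_measure) square_integrable_integrable: "square_integrable M f \<Longrightarrow> integrable M f"
  using square_integrable_mult[OF _ square_integrable_const, of f 1] by simp

lemmas square_integrable_intros =
  square_integrable_add square_integrable_diff square_integrable_cmult
  square_integrable_abs square_integrable_indicator_mult

lemma LINT_Cauchy_Schwarz:
  assumes "square_integrable M f" "square_integrable M g"
  shows "\<bar>LINT x|M. f x * g x\<bar> \<le> sqrt (LINT x|M. (f x)\<^sup>2) * sqrt (LINT x|M. (g x)\<^sup>2)"
proof -
  define A B C where "A = (LINT x|M. (f x)\<^sup>2)" and "B = (LINT x|M. (g x)\<^sup>2)"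
    and "C = (LINT x|M. f x * g x)"
  have "A \<ge> 0" "B \<ge> 0" by (auto simp: A_def B_def)
  have form_nonneg: "0 \<le> a\<^sup>2 * A + 2 * a * b * C + b\<^sup>2 * B" for a b
    using Bochner_Integration.integral_nonneg[of M "\<lambda>x. (a * f x + b * g x)\<^sup>2"]
    unfolding LINT_lincomb_power2[OF assms] A_def B_def C_def by simp
  have "C\<^sup>2 \<le> A * B"
  proof (cases "B = 0")
    case True
    have "C = 0"
    proof (rule ccontr)
      assume "C \<noteq> 0"
      thus False using form_nonneg[of 1 "- (A + 1) / (2 * C)"] True by (simp add: field_simps)
    qed
    thus ?thesis using \<open>A \<ge> 0\<close> \<open>B \<ge> 0\<close> by simp
  next
    case False
    have "0 \<le> B * (A * B - C\<^sup>2)"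
      using form_nonneg[of B "- C"] by (simp add: power2_eq_square algebra_simps)
    thus ?thesis using \<open>B \<ge> 0\<close> False by (simp add: zero_le_mult_iff)
  qed
  hence "\<bar>C\<bar> \<le> sqrt (A * B)" using real_sqrt_le_mono by fastforce
  thus ?thesis by (simp add: A_def B_def C_def real_sqrt_mult)
qed

lemma L2_tendstoD:
  assumes "L2_tendsto M \<phi> f"
  shows "square_integrable M (\<phi> n)" "square_integrable M f"
    "(\<lambda>n. LINT x|M. (\<phi> n x - f x)\<^sup>2) \<longlonglongrightarrow> 0"
  using assms by (auto simp: L2_tendsto_def)

lemma L2_tendsto_LINT_mult:
  assumes \<phi>: "L2_tendsto M \<phi> f" and \<gamma>: "L2_tendsto M \<gamma> g"
  shows "(\<lambda>n. LINT x|M. \<phi> n x * \<gamma> n x) \<longlonglongrightarrow> (LINT x|M. f x * g x)"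
proof -
  define a b where "a n = sqrt (LINT x|M. (\<phi> n x - f x)\<^sup>2)"
    and "b n = sqrt (LINT x|M. (\<gamma> n x - g x)\<^sup>2)" for n
  define A B where "A = sqrt (LINT x|M. (f x)\<^sup>2)" and "B = sqrt (LINT x|M. (g x)\<^sup>2)"
  note sq = L2_tendstoD(1,2)[OF \<phi>] L2_tendstoD(1,2)[OF \<gamma>]
  have bound: "norm ((LINT x|M. \<phi> n x * \<gamma> n x) - (LINT x|M. f x * g x))
      \<le> a n * b n + a n * B + A * b n" for n
  proof -
    have diff: "square_integrable M (\<lambda>x. \<phi> n x - f x)" "square_integrable M (\<lambda>x. \<gamma> n x - g x)"
      using sq by (auto intro: square_integrable_diff)
    have "(LINT x|M. \<phi> n x * \<gamma> n x) - (LINT x|M. f x * g x) = (LINT x|M. \<phi> n x * \<gamma> n x - f x * g x)"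
      using sq by (simp add: square_integrable_mult)
    also have "\<dots> = (LINT x|M. (\<phi> n x - f x) * (\<gamma> n x - g x) + (\<phi> n x - f x) * g x
        + f x * (\<gamma> n x - g x))"
      by (rule Bochner_Integration.integral_cong) (auto simp: algebra_simps)
    also have "\<dots> = (LINT x|M. (\<phi> n x - f x) * (\<gamma> n x - g x)) + (LINT x|M. (\<phi> n x - f x) * g x)
        + (LINT x|M. f x * (\<gamma> n x - g x))"
      using diff sq by (simp add: square_integrable_mult)
    finally show ?thesis
      using LINT_Cauchy_Schwarz[OF diff] LINT_Cauchy_Schwarz[OF diff(1) sq(4)]
          LINT_Cauchy_Schwarz[OF sq(2) diff(2)]
      unfolding a_def b_def A_def B_def real_norm_def by linarith
  qed
  have "a \<longlonglongrightarrow> 0" "b \<longlonglongrightarrow> 0"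
    using tendsto_real_sqrt[OF L2_tendstoD(3)[OF \<phi>]] tendsto_real_sqrt[OF L2_tendstoD(3)[OF \<gamma>]]
    by (simp_all add: a_def[abs_def] b_def[abs_def])
  hence "(\<lambda>n. a n * b n + a n * B + A * b n) \<longlonglongrightarrow> 0 * 0 + 0 * B + A * 0"
    by (intro tendsto_intros)
  hence "(\<lambda>n. a n * b n + a n * B + A * b n) \<longlonglongrightarrow> 0" by simp
  hence "(\<lambda>n. (LINT x|M. \<phi> n x * \<gamma> n x) - (LINT x|M. f x * g x)) \<longlonglongrightarrow> 0"
    by (rule Lim_null_comparison[rotated]) (use bound in auto)
  thus ?thesis by (simp add: LIM_zero_iff)
qed

lemma L2_tendsto_LINT_power2:
  "L2_tendsto M \<phi> f \<Longrightarrow> (\<lambda>n. LINT x|M. (\<phi> n x)\<^sup>2) \<longlonglongrightarrow> (LINT x|M. (f x)\<^sup>2)"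
  using L2_tendsto_LINT_mult[of M \<phi> f \<phi> f] by (simp add: power2_eq_square)

lemma L2_tendsto_Rayleigh_le:
  assumes \<phi>: "L2_tendsto M \<phi> f" and q: "q \<longlonglongrightarrow> Q" and "\<And>n. c * (LINT x|M. (\<phi> n x)\<^sup>2) \<le> q n"
  shows "c * (LINT x|M. (f x)\<^sup>2) \<le> Q"
  using assms(3) by (intro LIMSEQ_le[OF tendsto_mult_left[OF L2_tendsto_LINT_power2[OF \<phi>]] q]) simp

lemma L2_tendsto_const: "square_integrable M f \<Longrightarrow> L2_tendsto M (\<lambda>_. f) f"
  by (simp add: L2_tendsto_def)

lemma L2_tendsto_diff_scaled:
  assumes \<phi>: "L2_tendsto M \<phi> f" and h: "square_integrable M h" and t: "t \<longlonglongrightarrow> 0"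
  shows "L2_tendsto M (\<lambda>n x. \<phi> n x - t n * h x) f"
proof -
  note sq = L2_tendstoD(1,2)[OF \<phi>]
  have expand: "(LINT x|M. (\<phi> n x - t n * h x - f x)\<^sup>2) =
    (LINT x|M. (\<phi> n x - f x)\<^sup>2) - 2 * t n * (LINT x|M. (\<phi> n x - f x) * h x)
        + (t n)\<^sup>2 * (LINT x|M. (h x)\<^sup>2)" for n
    using LINT_lincomb_power2[OF square_integrable_diff[OF sq(1)[of n] sq(2)] h, of 1 "- t n"]
    by (simp add: algebra_simps)
  have "L2_tendsto M (\<lambda>n x. \<phi> n x - f x) (\<lambda>_. 0)"
    using \<phi> square_integrable_cmult[OF sq(2), of 0]
    by (simp add: L2_tendsto_def square_integrable_diff)
  from L2_tendsto_LINT_mult[OF this L2_tendsto_const[OF h]]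
  have "(\<lambda>n. LINT x|M. (\<phi> n x - f x) * h x) \<longlonglongrightarrow> 0" by simp
  hence "(\<lambda>n. (LINT x|M. (\<phi> n x - f x)\<^sup>2) - 2 * t n * (LINT x|M. (\<phi> n x - f x) * h x)
      + (t n)\<^sup>2 * (LINT x|M. (h x)\<^sup>2))
    \<longlonglongrightarrow> 0 - 2 * 0 * 0 + 0\<^sup>2 * (LINT x|M. (h x)\<^sup>2)"
    by (intro tendsto_intros t L2_tendstoD(3)[OF \<phi>])
  thus ?thesis
    unfolding L2_tendsto_def expand using sq h by (auto intro: square_integrable_intros)
qed

lemma L2_tendsto_dominated:
  assumes [measurable]: "\<And>n. \<phi> n \<in> borel_measurable M"
    and lim: "\<And>x. (\<lambda>n. \<phi> n x) \<longlonglongrightarrow> f x"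
    and bound: "\<And>n x. \<bar>\<phi> n x\<bar> \<le> w x" and w: "square_integrable M w"
  shows "L2_tendsto M \<phi> f"
  unfolding L2_tendsto_def
proof (intro conjI allI)
  have [measurable]: "f \<in> borel_measurable M" by (rule borel_measurable_LIMSEQ_real[OF lim]) simp
  have limit_bound: "\<bar>f x\<bar> \<le> w x" for x
    by (rule LIMSEQ_le_const2[OF tendsto_rabs[OF lim]]) (use bound in auto)
  show "square_integrable M (\<phi> n)" for n
    by (rule square_integrable_bound[OF w _ order_trans[OF bound abs_ge_self]]) simp
  show f: "square_integrable M f"
    by (rule square_integrable_bound[OF w _ order_trans[OF limit_bound abs_ge_self]]) simp
  have diff_bound: "\<bar>\<phi> n x - f x\<bar> \<le> \<bar>2 * w x\<bar>" for n x
    using bound[of n x] limit_bound[of x] by linarith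
  have "(\<lambda>n. LINT x|M. (\<phi> n x - f x)\<^sup>2) \<longlonglongrightarrow> (LINT x|M. 0)"
  proof (rule integral_dominated_convergence[where w="\<lambda>x. (2 * w x)\<^sup>2"])
    show "integrable M (\<lambda>x. (2 * w x)\<^sup>2)"
      by (intro square_integrable_power2 square_integrable_cmult w)
    have "(\<lambda>n. (\<phi> n x - f x)\<^sup>2) \<longlonglongrightarrow> (f x - f x)\<^sup>2" for x
      by (intro tendsto_intros lim)
    thus "AE x in M. (\<lambda>n. (\<phi> n x - f x)\<^sup>2) \<longlonglongrightarrow> 0" by simp
    show "AE x in M. norm ((\<phi> n x - f x)\<^sup>2) \<le> (2 * w x)\<^sup>2" for n
      using abs_le_square_iff[THEN iffD1, OF diff_bound] by simp
  qed auto
  thus "(\<lambda>n. LINT x|M. (\<phi> n x - f x)\<^sup>2) \<longlonglongrightarrow> 0" by simp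
qed

lemma L2_tendsto_AE_subseq:
  assumes "L2_tendsto M \<phi> f"
  obtains r :: "nat \<Rightarrow> nat" where "strict_mono r" "AE x in M. (\<lambda>n. \<phi> (r n) x) \<longlonglongrightarrow> f x"
proof -
  have "\<exists>r::nat \<Rightarrow> nat. strict_mono r \<and> (AE x in M. (\<lambda>n. (\<phi> (r n) x - f x)\<^sup>2) \<longlonglongrightarrow> 0)"
  proof (rule tendsto_L1_AE_subseq)
    show "integrable M (\<lambda>x. (\<phi> n x - f x)\<^sup>2)" for n
      by (intro square_integrable_power2 square_integrable_diff L2_tendstoD[OF assms])
    show "(\<lambda>n. LINT x|M. norm ((\<phi> n x - f x)\<^sup>2)) \<longlonglongrightarrow> 0"
      using L2_tendstoD(3)[OF assms] by simp
  qed
  then obtain r :: "nat \<Rightarrow> nat" where r: "strict_mono r"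
    and ae: "AE x in M. (\<lambda>n. (\<phi> (r n) x - f x)\<^sup>2) \<longlonglongrightarrow> 0"
    by blast
  have "AE x in M. (\<lambda>n. \<phi> (r n) x) \<longlonglongrightarrow> f x"
    using ae
  proof eventually_elim
    case (elim x)
    hence "(\<lambda>n. sqrt ((\<phi> (r n) x - f x)\<^sup>2)) \<longlonglongrightarrow> sqrt 0" by (rule tendsto_real_sqrt)
    hence "(\<lambda>n. \<phi> (r n) x - f x) \<longlonglongrightarrow> 0" by (simp add: tendsto_rabs_zero_iff)
    thus ?case by (rule LIM_zero_cancel)
  qed
  thus ?thesis by (rule that[OF r])
qed

lemma Fatou_integrable:
  fixes h :: "nat \<Rightarrow> 'a \<Rightarrow> real"
  assumes h: "\<And>n. integrable M (h n)" "\<And>n x. h n x \<ge> 0"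
    and lim: "\<And>x. (\<lambda>n. h n x) \<longlonglongrightarrow> H x" and bound: "\<And>n. (LINT x|M. h n x) \<le> C"
  shows "integrable M H"
proof (rule integrableI_nonneg)
  have [measurable]: "h n \<in> borel_measurable M" for n using h(1) by auto
  show [measurable]: "H \<in> borel_measurable M" by (rule borel_measurable_LIMSEQ_real[OF lim]) simp
  show "AE x in M. H x \<ge> 0" using LIMSEQ_le_const[OF lim] h(2) by blast
  have "(\<integral>\<^sup>+x. ennreal (H x) \<partial>M) = (\<integral>\<^sup>+x. liminf (\<lambda>n. ennreal (h n x)) \<partial>M)"
    by (intro nn_integral_cong lim_imp_Liminf[symmetric] tendsto_ennrealI lim) simp
  also have "\<dots> \<le> liminf (\<lambda>n. \<integral>\<^sup>+x. ennreal (h n x) \<partial>M)"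
    by (rule nn_integral_liminf) measurable
  also have "\<dots> = liminf (\<lambda>n. ennreal (LINT x|M. h n x))"
    using h by (simp add: nn_integral_eq_integral)
  also have "\<dots> \<le> liminf (\<lambda>n. ennreal C)"
    by (intro Liminf_mono always_eventually allI ennreal_leI bound)
  also have "\<dots> < \<infinity>" by (simp add: Liminf_const)
  finally show "(\<integral>\<^sup>+x. ennreal (H x) \<partial>M) < \<infinity>" .
qed

definition difference_closed :: "('a \<Rightarrow> real) set \<Rightarrow> (('a \<Rightarrow> real) \<Rightarrow> 'b \<Rightarrow> real) \<Rightarrow> bool" where
  "difference_closed T A \<longleftrightarrow> (\<forall>\<phi>\<in>T. \<forall>\<psi>\<in>T. \<forall>c. (\<lambda>x. \<phi> x - c * \<psi> x) \<in> T \<and>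
     A (\<lambda>x. \<phi> x - c * \<psi> x) = (\<lambda>x. A \<phi> x - c * A \<psi> x))"

text \<open>Approximants are made orthogonal to \<open>b\<close> by subtracting a vanishing multiple of one fixed
  approximant that is not orthogonal to \<open>b\<close>.\<close>

lemma orthogonal_approximation_step:
  assumes closed: "difference_closed T A" and T: "\<And>n. \<phi> n \<in> T"
    and \<phi>: "L2_tendsto M \<phi> f" and A\<phi>: "L2_tendsto N (\<lambda>n. A (\<phi> n)) g"
    and b: "square_integrable M b" and orth: "(LINT x|M. f x * b x) = 0"
  obtains \<psi> where "\<And>n. \<psi> n \<in> T" "\<And>n. (LINT x|M. \<psi> n x * b x) = 0"
    "L2_tendsto M \<psi> f" "L2_tendsto N (\<lambda>n. A (\<psi> n)) g"
proof (cases "\<exists>m. (LINT x|M. \<phi> m x * b x) \<noteq> 0")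
  case True
  then obtain m where m: "(LINT x|M. \<phi> m x * b x) \<noteq> 0" by blast
  define t where "t n = (LINT x|M. \<phi> n x * b x) / (LINT x|M. \<phi> m x * b x)" for n
  have "t \<longlonglongrightarrow> (LINT x|M. f x * b x) / (LINT x|M. \<phi> m x * b x)"
    unfolding t_def
    by (intro tendsto_divide tendsto_const m L2_tendsto_LINT_mult \<phi> L2_tendsto_const b)
  hence t: "t \<longlonglongrightarrow> 0" using orth by simp
  define \<psi> where "\<psi> n x = \<phi> n x - t n * \<phi> m x" for n x
  show ?thesis
  proof (rule that[of \<psi>])
    show "\<psi> n \<in> T" for n
      using closed T unfolding difference_closed_def \<psi>_def by blast
    show "(LINT x|M. \<psi> n x * b x) = 0" for n
    proof -
      have "(LINT x|M. \<psi> n x * b x) = (LINT x|M. \<phi> n x * b x - t n * (\<phi> m x * b x))"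
        unfolding \<psi>_def by (simp add: algebra_simps)
      also have "\<dots> = (LINT x|M. \<phi> n x * b x) - t n * (LINT x|M. \<phi> m x * b x)"
        using square_integrable_mult[OF L2_tendstoD(1)[OF \<phi>] b] by simp
      finally show ?thesis using m by (simp add: t_def)
    qed
    show "L2_tendsto M \<psi> f"
      unfolding \<psi>_def by (intro L2_tendsto_diff_scaled \<phi> t L2_tendstoD(1)[OF \<phi>])
    have "A (\<psi> n) = (\<lambda>x. A (\<phi> n) x - t n * A (\<phi> m) x)" for n
      using closed T unfolding difference_closed_def \<psi>_def by blast
    thus "L2_tendsto N (\<lambda>n. A (\<psi> n)) g"
      by (simp only:) (intro L2_tendsto_diff_scaled A\<phi> t L2_tendstoD(1)[OF A\<phi>])
  qed
next
  case False
  thus ?thesis using T \<phi> A\<phi> by (intro that) auto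
qed

lemma orthogonal_approximation:
  fixes k :: nat
  assumes "difference_closed T A" "\<And>\<phi>. \<phi> \<in> T \<Longrightarrow> square_integrable M \<phi>" "\<And>n. \<phi> n \<in> T"
    and "L2_tendsto M \<phi> f" "L2_tendsto N (\<lambda>n. A (\<phi> n)) g"
    and "\<And>i. i < k \<Longrightarrow> square_integrable M (b i)" "\<And>i. i < k \<Longrightarrow> (LINT x|M. f x * b i x) = 0"
  shows "\<exists>\<psi>. (\<forall>n. \<psi> n \<in> T) \<and> (\<forall>n. \<forall>i<k. (LINT x|M. \<psi> n x * b i x) = 0) \<and>
    L2_tendsto M \<psi> f \<and> L2_tendsto N (\<lambda>n. A (\<psi> n)) g"
  using assms
proof (induction k arbitrary: T \<phi>)
  case 0
  thus ?case by auto
next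
  case (Suc k)
  note closed = Suc.prems(1) and T = Suc.prems(2) and b = Suc.prems(6)
  obtain \<psi> where \<psi>: "\<And>n. \<psi> n \<in> T" "\<And>n. (LINT x|M. \<psi> n x * b k x) = 0"
    "L2_tendsto M \<psi> f" "L2_tendsto N (\<lambda>n. A (\<psi> n)) g"
    using orthogonal_approximation_step[OF closed Suc.prems(3-5) b[OF lessI] Suc.prems(7)[OF lessI]]
    by blast
  define T' where "T' = {\<phi> \<in> T. (LINT x|M. \<phi> x * b k x) = 0}"
  have "(LINT x|M. (\<phi> x - c * \<psi> x) * b k x) = 0" if "\<phi> \<in> T'" "\<psi> \<in> T'" for \<phi> \<psi> c
  proof -
    have "integrable M (\<lambda>x. \<phi> x * b k x)" "integrable M (\<lambda>x. \<psi> x * b k x)"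
      using that T b by (auto simp: T'_def intro: square_integrable_mult)
    thus ?thesis using that by (simp add: T'_def left_diff_distrib mult.assoc)
  qed
  hence "difference_closed T' A"
    using closed unfolding difference_closed_def T'_def by blast
  moreover have "\<psi> n \<in> T'" for n using \<psi>(1,2) by (simp add: T'_def)
  ultimately obtain \<psi>' where "\<forall>n. \<psi>' n \<in> T'" "\<forall>n. \<forall>i<k. (LINT x|M. \<psi>' n x * b i x) = 0"
    "L2_tendsto M \<psi>' f" "L2_tendsto N (\<lambda>n. A (\<psi>' n)) g"
    using Suc.IH[of T' \<psi>] Suc.prems \<psi>(3,4) by (auto simp: T'_def)
  thus ?case by (intro exI[of _ \<psi>']) (auto simp: T'_def less_Suc_eq)
qed

section \<open>Lower bound for a Riccati equation with strongly convex potential\<close>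

lemma filterlim_at_top_DERIV_ge:
  fixes f f' :: "real \<Rightarrow> real"
  assumes f: "\<And>x. (f has_real_derivative f' x) (at x)" and "c > 0"
    and ge: "\<forall>\<^sub>F x in at_top. f' x \<ge> c"
  shows "filterlim f at_top at_top"
proof -
  obtain a where a: "\<And>x. x \<ge> a \<Longrightarrow> f' x \<ge> c"
    using ge unfolding eventually_at_top_linorder by blast
  have "f a - c * a \<le> f x - c * x" if "x \<ge> a" for x
  proof (rule DERIV_nonneg_imp_nondecreasing[OF that, of "\<lambda>x. f x - c * x"])
    fix t assume "a \<le> t"
    thus "\<exists>d. ((\<lambda>x. f x - c * x) has_real_derivative d) (at t) \<and> 0 \<le> d"
      using a[of t] by (intro exI[of _ "f' t - c"]) (auto intro!: derivative_eq_intros f)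
  qed
  hence "\<forall>\<^sub>F x in at_top. f a - c * a + c * x \<le> f x"
    unfolding eventually_at_top_linorder by (intro exI[of _ a]) (auto simp: algebra_simps)
  moreover have "filterlim (\<lambda>x. f a - c * a + c * x) at_top at_top"
    using \<open>c > 0\<close>
    by (intro filterlim_tendsto_add_at_top[OF tendsto_const]
        filterlim_tendsto_pos_mult_at_top[OF tendsto_const] filterlim_ident)
  ultimately show ?thesis by (rule filterlim_at_top_mono[rotated])
qed

lemma DERIV_reflect:
  fixes f f' :: "real \<Rightarrow> real"
  assumes "\<And>x. (f has_real_derivative f' x) (at x)"
  shows "((\<lambda>x. f (- x)) has_real_derivative - f' (- x)) (at x)"
  using assms by (simp add: DERIV_mirror[symmetric])

lemma strongly_convex_tendsto_at_infinity:
  fixes f f' f'' :: "real \<Rightarrow> real"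
  assumes f: "\<And>x. (f has_real_derivative f' x) (at x)" "\<And>x. (f' has_real_derivative f'' x) (at x)"
    and "c > 0" "\<And>x. f'' x \<ge> c"
  shows "filterlim f at_top at_infinity"
proof -
  have at_top: "filterlim g at_top at_top"
    if g: "\<And>x. (g has_real_derivative g' x) (at x)" "\<And>x. (g' has_real_derivative g'' x) (at x)"
      and ge: "\<And>x. g'' x \<ge> c" for g g' g'' :: "real \<Rightarrow> real"
  proof -
    have "filterlim g' at_top at_top"
      using ge by (intro filterlim_at_top_DERIV_ge[OF g(2) \<open>c > 0\<close>]) auto
    hence "\<forall>\<^sub>F x in at_top. g' x \<ge> 1" by (simp add: filterlim_at_top)
    thus ?thesis by (rule filterlim_at_top_DERIV_ge[OF g(1) zero_less_one])
  qed
  have "((\<lambda>x. - f' (- x)) has_real_derivative f'' (- x)) (at x)" for x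
    using DERIV_minus[OF DERIV_reflect[OF f(2)]] by simp
  hence "filterlim (\<lambda>x. f (- x)) at_top at_top"
    using assms(4) by (intro at_top[OF DERIV_reflect[OF f(1)]]) auto
  hence "filterlim f at_top at_bot" by (simp add: filterlim_at_bot_mirror)
  moreover have "filterlim f at_top at_top" using assms by (intro at_top[of f f' f'']) auto
  ultimately show ?thesis by (simp add: at_infinity_eq_at_top_bot filterlim_sup)
qed

lemma antiderivative_bounded_by_LINT:
  assumes y: "integrable lborel y" "\<And>x. y x \<ge> 0" "continuous_on UNIV y"
    and Y: "\<And>x. (Y has_real_derivative y x) (at x)" and "a \<le> b"
  shows "Y b - Y a \<le> (LINT x|lborel. y x)"
proof -
  have "Y b - Y a = (LINT x:{a..b}|lborel. y x)" using LINT_Icc_deriv[OF \<open>a \<le> b\<close> Y y(3)] by simp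
  also have "\<dots> \<le> (LINT x|lborel. y x)"
    unfolding set_lebesgue_integral_def
    using y integrable_mult_indicator[OF _ y(1), of "{a..b}"]
    by (intro integral_mono) (auto split: split_indicator)
  finally show ?thesis .
qed

lemma integrable_not_eventually_DERIV2_ge:
  fixes y y' y'' :: "real \<Rightarrow> real"
  assumes y: "integrable lborel y" "\<And>x. y x \<ge> 0"
    and deriv: "\<And>x. (y has_real_derivative y' x) (at x)" "\<And>x. (y' has_real_derivative y'' x) (at x)"
    and "e > 0" "k \<ge> 0"
  shows "\<not> (\<forall>\<^sub>F x in at_top. y'' x \<ge> e - k * y x)"
proof
  assume ge: "\<forall>\<^sub>F x in at_top. y'' x \<ge> e - k * y x"
  define I where "I = (LINT x|lborel. y x)"
  note y_cont = DERIV_continuous_on_UNIV[OF deriv(1)]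
  obtain Y where Y: "\<And>x. (Y has_real_derivative y x) (at x)" "Y 0 = 0"
    using continuous_antiderivative[OF y_cont] by blast
  have Y_le: "\<forall>\<^sub>F x in at_top. Y x \<le> I"
    using eventually_ge_at_top[of 0]
    by eventually_elim
      (use antiderivative_bounded_by_LINT[OF y y_cont Y(1)] Y(2) in \<open>fastforce simp: I_def\<close>)
  have "filterlim (\<lambda>x. y' x + k * Y x) at_top at_top"
  proof (rule filterlim_at_top_DERIV_ge[OF _ \<open>e > 0\<close>])
    show "((\<lambda>x. y' x + k * Y x) has_real_derivative y'' x + k * y x) (at x)" for x
      by (auto intro!: derivative_eq_intros deriv Y)
    show "\<forall>\<^sub>F x in at_top. e \<le> y'' x + k * y x"
      using ge by eventually_elim simp
  qed
  hence "filterlim (\<lambda>x. - (k * I) + (y' x + k * Y x)) at_top at_top"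
    by (rule filterlim_tendsto_add_at_top[OF tendsto_const])
  moreover have "\<forall>\<^sub>F x in at_top. - (k * I) + (y' x + k * Y x) \<le> y' x"
    using Y_le by eventually_elim (use mult_left_mono[OF _ \<open>k \<ge> 0\<close>] in auto)
  ultimately have "filterlim y' at_top at_top" by (rule filterlim_at_top_mono)
  hence "\<forall>\<^sub>F x in at_top. y' x \<ge> 1" by (simp add: filterlim_at_top)
  hence "filterlim y at_top at_top" by (rule filterlim_at_top_DERIV_ge[OF deriv(1) zero_less_one])
  hence "\<forall>\<^sub>F x in at_top. y x \<ge> 1" by (simp add: filterlim_at_top)
  hence "filterlim Y at_top at_top" by (rule filterlim_at_top_DERIV_ge[OF Y(1) zero_less_one])
  hence "\<forall>\<^sub>F x in at_top. Y x > I" by (simp add: filterlim_at_top_dense)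
  with Y_le have "\<forall>\<^sub>F x :: real in at_top. False" by eventually_elim simp
  thus False by simp
qed

lemma negative_region_nonincreasing:
  fixes K K' z z' :: "real \<Rightarrow> real"
  assumes K: "\<And>x. (K has_real_derivative K' x) (at x)"
    and z: "\<And>x. (z has_real_derivative z' x) (at x)"
    and K'_nonpos: "\<And>x. z x \<le> 0 \<Longrightarrow> K' x \<le> 0" and z'_nonpos: "\<And>x. K x < 0 \<Longrightarrow> z' x \<le> 0"
    and start: "K a < 0" "z a \<le> 0" and "a \<le> b"
  shows "K b \<le> K a"
proof -
  have K_le: "K c \<le> K a" if "a \<le> c" and neg: "\<And>t. a \<le> t \<Longrightarrow> t < c \<Longrightarrow> K t < 0" for c
  proof (rule DERIV_nonpos_imp_nonincreasing[OF \<open>a \<le> c\<close>])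
    fix t assume t: "a \<le> t" "t \<le> c"
    have "z t \<le> z a"
    proof (rule DERIV_nonpos_imp_decreasing_open[OF t(1)])
      show "\<exists>d. (z has_real_derivative d) (at s) \<and> d \<le> 0" if "a < s" "s < t" for s
        using z z'_nonpos neg that t by (meson less_imp_le less_le_trans)
      show "continuous_on {a..t} z"
        using DERIV_continuous_on_UNIV[OF z] by (rule continuous_on_subset) simp
    qed
    thus "\<exists>d. (K has_real_derivative d) (at t) \<and> d \<le> 0" using K K'_nonpos start(2) by fastforce
  qed
  have "K t < 0" if "a \<le> t" for t
  proof (rule ccontr)
    assume "\<not> K t < 0"
    define A where "A = {a..t} \<inter> {x. 0 \<le> K x}"
    have "closed {x. 0 \<le> K x}"
      using DERIV_continuous_on_UNIV[OF K] by (intro closed_Collect_le continuous_intros) auto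
    hence "compact A" unfolding A_def by (intro compact_Int_closed) auto
    moreover have "t \<in> A" using that \<open>\<not> K t < 0\<close> by (simp add: A_def)
    ultimately obtain c where c: "c \<in> A" "\<And>s. s \<in> A \<Longrightarrow> c \<le> s"
      using compact_attains_inf[of A] by blast
    have "K s < 0" if "a \<le> s" "s < c" for s
      using c(1) c(2)[of s] that by (force simp: A_def)
    hence "K c \<le> K a" using K_le[of c] c(1) by (simp add: A_def)
    thus False using start(1) c(1) by (simp add: A_def)
  qed
  thus ?thesis using K_le[OF \<open>a \<le> b\<close>] by blast
qed

locale convex_riccati =
  fixes u p W W' W'' :: "real \<Rightarrow> real" and l k :: real
  assumes u_nonzero: "u x \<noteq> 0"
    and u_DERIV: "(u has_real_derivative - p x * u x) (at x)"
    and u_square_integrable: "integrable lborel (\<lambda>x. (u x)\<^sup>2)"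
    and p_DERIV: "(p has_real_derivative (p x)\<^sup>2 - W x + l) (at x)"
    and W_DERIV: "(W has_real_derivative W' x) (at x)"
    and W'_DERIV: "(W' has_real_derivative W'' x) (at x)"
    and W''_ge: "W'' x \<ge> 2 * k\<^sup>2"
    and k_pos: "k > 0"
begin

text \<open>With \<open>q = p'\<close>, the functions \<open>K = (q - k) u\<^sup>2\<close> and \<open>z = 2 k p - W'\<close> satisfy
  \<open>K' = z u\<^sup>2\<close> and \<open>z' \<le> 2 k K / u\<^sup>2\<close>. If \<open>K < 0\<close> and \<open>z \<le> 0\<close> at one point, then
  \<open>K\<close> stays below a negative constant to the right of it, and there
  \<open>(u\<^sup>2)'' \<ge> - 2 q u\<^sup>2 = - 2 K - 2 k u\<^sup>2\<close> contradicts the integrability of \<open>u\<^sup>2\<close>.\<close>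

lemma riccati_deriv_ge_if_nonpos:
  assumes z_nonpos: "2 * k * p a - W' a \<le> 0"
  shows "(p a)\<^sup>2 - W a + l \<ge> k"
proof (rule ccontr)
  assume less: "\<not> ?thesis"
  define q where "q x = (p x)\<^sup>2 - W x + l" for x
  define K where "K x = (q x - k) * (u x)\<^sup>2" for x
  define z where "z x = 2 * k * p x - W' x" for x
  have q: "(q has_real_derivative 2 * p x * q x - W' x) (at x)" for x
    unfolding q_def by (auto intro!: derivative_eq_intros p_DERIV W_DERIV)
  have u2: "((\<lambda>x. (u x)\<^sup>2) has_real_derivative - 2 * p x * (u x)\<^sup>2) (at x)" for x
    by (auto intro!: derivative_eq_intros u_DERIV simp: power2_eq_square)
  have K: "(K has_real_derivative z x * (u x)\<^sup>2) (at x)" for x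
    using DERIV_mult[OF DERIV_diff[OF q DERIV_const[of k]] u2]
    unfolding K_def z_def by (simp add: algebra_simps)
  have z: "(z has_real_derivative 2 * k * q x - W'' x) (at x)" for x
    unfolding z_def q_def by (auto intro!: derivative_eq_intros W'_DERIV p_DERIV)
  have K_neg_iff: "K x < 0 \<longleftrightarrow> q x < k" for x
    using u_nonzero[of x] by (auto simp: K_def mult_less_0_iff)
  have K_start: "K a < 0" using less K_neg_iff q_def by simp
  have K_le: "K b \<le> K a" if "a \<le> b" for b
  proof (rule negative_region_nonincreasing[OF K z _ _ K_start _ that])
    show "2 * k * q x - W'' x \<le> 0" if "K x < 0" for x
    proof -
      have "2 * k * q x \<le> 2 * k * k" using that k_pos K_neg_iff by (intro mult_left_mono) auto
      thus ?thesis using W''_ge[of x] by (simp add: power2_eq_square)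
    qed
  qed (use z_nonpos in \<open>auto simp: z_def mult_le_0_iff\<close>)
  have "((\<lambda>x. - 2 * p x * (u x)\<^sup>2) has_real_derivative
      4 * (p x * u x)\<^sup>2 - 2 * q x * (u x)\<^sup>2) (at x)" for x
    using DERIV_mult[OF DERIV_cmult[OF p_DERIV, of "-2"] u2]
    unfolding q_def by (simp add: power2_eq_square algebra_simps)
  from integrable_not_eventually_DERIV2_ge[OF u_square_integrable _ u2 this, of "- 2 * K a" "2 * k"]
  have "\<not> (\<forall>\<^sub>F x in at_top. 4 * (p x * u x)\<^sup>2 - 2 * q x * (u x)\<^sup>2 \<ge> - 2 * K a - 2 * k * (u x)\<^sup>2)"
    using K_start k_pos by simp
  moreover have "4 * (p x * u x)\<^sup>2 - 2 * q x * (u x)\<^sup>2 \<ge> - 2 * K a - 2 * k * (u x)\<^sup>2"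
    if "x \<ge> a" for x
    using K_le[OF that] zero_le_power2[of "p x * u x"]
    unfolding K_def[of x] left_diff_distrib by linarith
  ultimately show False by (auto simp: eventually_at_top_linorder)
qed

lemma convex_riccati_reflect:
  "convex_riccati (\<lambda>x. u (- x)) (\<lambda>x. - p (- x)) (\<lambda>x. W (- x)) (\<lambda>x. - W' (- x)) (\<lambda>x. W'' (- x)) l k"
proof
  show "integrable lborel (\<lambda>x. (u (- x))\<^sup>2)"
    using lborel_integrable_real_affine[OF u_square_integrable, of "-1" 0] by simp
  show "((\<lambda>x. u (- x)) has_real_derivative - (- p (- x)) * u (- x)) (at x)" for x
    using DERIV_reflect[OF u_DERIV] by simp
  show "((\<lambda>x. - p (- x)) has_real_derivative (- p (- x))\<^sup>2 - W (- x) + l) (at x)" for x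
    using DERIV_minus[OF DERIV_reflect[OF p_DERIV]] by (simp add: algebra_simps)
  show "((\<lambda>x. - W' (- x)) has_real_derivative W'' (- x)) (at x)" for x
    using DERIV_minus[OF DERIV_reflect[OF W'_DERIV]] by simp
qed (rule u_nonzero DERIV_reflect W_DERIV W''_ge k_pos)+

theorem riccati_deriv_ge: "(p x)\<^sup>2 - W x + l \<ge> k"
proof (cases "2 * k * p x - W' x \<le> 0")
  case True
  thus ?thesis by (rule riccati_deriv_ge_if_nonpos)
next
  case False
  thus ?thesis using convex_riccati.riccati_deriv_ge_if_nonpos[OF convex_riccati_reflect, of "- x"] by simp
qed

end

section \<open>Smooth functions\<close>

lemma smooth_DERIV: "smooth f \<Longrightarrow> (f has_real_derivative deriv f x) (at x)"
  unfolding smooth_def by (metis funpow_0 DERIV_deriv_iff_real_differentiable)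

lemma smooth_deriv: "smooth f \<Longrightarrow> smooth (deriv f)"
  unfolding smooth_def by (metis comp_apply funpow_Suc_right)

lemma smooth_continuous: "smooth f \<Longrightarrow> continuous_on UNIV f"
  using smooth_DERIV DERIV_continuous_on_UNIV by blast

lemma smooth_coinduct:
  assumes "P f"
    and closed: "\<And>g. P g \<Longrightarrow> \<exists>g'. (\<forall>x. (g has_real_derivative g' x) (at x)) \<and> P g'"
  shows "smooth f"
proof -
  have deriv: "P (deriv g) \<and> g differentiable at x" if "P g" for g x
  proof -
    obtain g' where g': "\<And>x. (g has_real_derivative g' x) (at x)" "P g'"
      using closed[OF \<open>P g\<close>] by blast
    hence "deriv g = g'" using DERIV_imp_deriv by blast
    thus ?thesis using g' real_differentiable_def by blast
  qed
  have "P ((deriv ^^ n) f)" for n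
    by (induction n) (use \<open>P f\<close> deriv in auto)
  thus ?thesis using deriv unfolding smooth_def by blast
qed

lemma smooth_if_deriv_smooth:
  assumes "\<And>x. (f has_real_derivative f' x) (at x)" "smooth f'"
  shows "smooth f"
  by (rule smooth_coinduct[of "\<lambda>g. g = f \<or> smooth g"])
    (use assms smooth_DERIV smooth_deriv in blast)+

inductive function_ring :: "(real \<Rightarrow> real) set \<Rightarrow> (real \<Rightarrow> real) \<Rightarrow> bool" for S where
  const: "function_ring S (\<lambda>_. c)"
| generator: "f \<in> S \<Longrightarrow> function_ring S f"
| add: "function_ring S f \<Longrightarrow> function_ring S g \<Longrightarrow> function_ring S (\<lambda>x. f x + g x)"
| mult: "function_ring S f \<Longrightarrow> function_ring S g \<Longrightarrow> function_ring S (\<lambda>x. f x * g x)"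

lemma smooth_function_ring:
  assumes "function_ring S f"
    and generators: "\<And>g. g \<in> S \<Longrightarrow>
      \<exists>g'. (\<forall>x. (g has_real_derivative g' x) (at x)) \<and> function_ring S g'"
  shows "smooth f"
  using assms(1)
proof (rule smooth_coinduct)
  show "\<exists>g'. (\<forall>x. (g has_real_derivative g' x) (at x)) \<and> function_ring S g'"
    if "function_ring S g" for g
    using that
  proof induction
    case (const c)
    show ?case using function_ring.const[of S 0] by (intro exI[of _ "\<lambda>_. 0"]) simp
  next
    case (generator f)
    thus ?case by (rule generators)
  next
    case (add f g)
    then obtain f' g' where f': "\<And>x. (f has_real_derivative f' x) (at x)" "function_ring S f'"
      and g': "\<And>x. (g has_real_derivative g' x) (at x)" "function_ring S g'" by blast
    have "((\<lambda>x. f x + g x) has_real_derivative f' x + g' x) (at x)" for x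
      by (intro DERIV_add f' g')
    thus ?case using function_ring.add[OF f'(2) g'(2)] by (intro exI conjI allI)
  next
    case (mult f g)
    then obtain f' g' where f': "\<And>x. (f has_real_derivative f' x) (at x)" "function_ring S f'"
      and g': "\<And>x. (g has_real_derivative g' x) (at x)" "function_ring S g'" by blast
    have "((\<lambda>x. f x * g x) has_real_derivative f' x * g x + g' x * f x) (at x)" for x
      by (intro DERIV_mult f' g')
    moreover have "function_ring S (\<lambda>x. f' x * g x + g' x * f x)"
      by (intro function_ring.add function_ring.mult f' g' mult.hyps)
    ultimately show ?case by (intro exI conjI allI)
  qed
qed

lemma
  shows smooth_const: "smooth (\<lambda>_. c)"
    and smooth_add: "smooth f \<Longrightarrow> smooth g \<Longrightarrow> smooth (\<lambda>x. f x + g x)"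
    and smooth_mult: "smooth f \<Longrightarrow> smooth g \<Longrightarrow> smooth (\<lambda>x. f x * g x)"
proof -
  have smooth: "smooth f" if "function_ring (Collect smooth) f" for f
    using that
  proof (rule smooth_function_ring)
    fix g assume "g \<in> Collect smooth"
    hence "function_ring (Collect smooth) (deriv g)" "\<And>x. (g has_real_derivative deriv g x) (at x)"
      by (auto intro: function_ring.generator smooth_deriv smooth_DERIV)
    thus "\<exists>g'. (\<forall>x. (g has_real_derivative g' x) (at x)) \<and> function_ring (Collect smooth) g'"
      by (intro exI[of _ "deriv g"]) simp
  qed
  show "smooth (\<lambda>_. c)" by (intro smooth function_ring.const)
  show "smooth (\<lambda>x. f x + g x)" if "smooth f" "smooth g"
    using that by (intro smooth function_ring.add function_ring.generator) auto
  show "smooth (\<lambda>x. f x * g x)" if "smooth f" "smooth g"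
    using that by (intro smooth function_ring.mult function_ring.generator) auto
qed

lemma smooth_affine:
  assumes "smooth f"
  shows "smooth (\<lambda>x. f (a * x + b))"
proof (rule smooth_coinduct[of "\<lambda>h. \<exists>g c. smooth g \<and> h = (\<lambda>x. c * g (a * x + b))"])
  show "\<exists>g c. smooth g \<and> (\<lambda>x. f (a * x + b)) = (\<lambda>x. c * g (a * x + b))"
    using assms by (intro exI[of _ f] exI[of _ 1]) simp
  fix h assume "\<exists>g c. smooth g \<and> h = (\<lambda>x. c * g (a * x + b))"
  then obtain g c where g: "smooth g" and h: "h = (\<lambda>x. c * g (a * x + b))" by blast
  have "(h has_real_derivative (c * a) * deriv g (a * x + b)) (at x)" for x
    unfolding h by (auto intro!: derivative_eq_intros DERIV_chain2[OF smooth_DERIV[OF g]])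
  thus "\<exists>h'. (\<forall>x. (h has_real_derivative h' x) (at x)) \<and>
      (\<exists>g c. smooth g \<and> h' = (\<lambda>x. c * g (a * x + b)))"
    using smooth_deriv[OF g] by (intro exI[of _ "\<lambda>x. (c * a) * deriv g (a * x + b)"]) blast
qed

lemma smooth_deriv_mult:
  assumes "smooth f" "smooth g"
  shows "deriv (\<lambda>x. f x * g x) x = deriv f x * g x + f x * deriv g x"
  using DERIV_mult[OF smooth_DERIV[OF assms(1)] smooth_DERIV[OF assms(2)]]
  by (auto intro!: DERIV_imp_deriv simp: mult.commute)

lemma smooth_real_polynomial_function: "real_polynomial_function p \<Longrightarrow> smooth p"
  by (rule smooth_coinduct[of real_polynomial_function])
    (use has_real_derivative_polynomial_function in blast)+

text \<open>The factors \<open>x\<^sup>-\<^sup>k\<close> make the family closed under differentiation up to linear combinations.\<close>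

definition flat_exp :: "nat \<Rightarrow> real \<Rightarrow> real" where
  "flat_exp k x = (if x > 0 then (1 / x) ^ k * exp (- (1 / x)) else 0)"

lemma flat_exp_tendsto_0: "(flat_exp k \<longlongrightarrow> 0) (at 0)"
proof -
  have "((\<lambda>x. (1 / x) ^ k / exp (1 / x)) \<longlongrightarrow> (0::real)) (at_right 0)"
    using filterlim_compose[OF tendsto_power_div_exp_0 filterlim_inverse_at_top_right]
    by (simp add: inverse_eq_divide)
  hence "(flat_exp k \<longlongrightarrow> 0) (at_right 0)"
    by (rule Lim_transform_eventually)
      (auto simp: eventually_at_right_field flat_exp_def exp_minus field_simps intro!: exI[of _ 1])
  moreover have "(flat_exp k \<longlongrightarrow> 0) (at_left 0)"
    by (rule Lim_transform_eventually[OF tendsto_const])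
      (auto simp: eventually_at_left_field flat_exp_def intro!: exI[of _ "-1"])
  ultimately show ?thesis by (simp add: filterlim_split_at)
qed

lemma flat_exp_DERIV:
  "(flat_exp k has_real_derivative flat_exp (k + 2) x + - real k * flat_exp (k + 1) x) (at x)"
proof (cases x "0 :: real" rule: linorder_cases)
  case greater
  have "((\<lambda>x. (1 / x) ^ k * exp (- (1 / x))) has_real_derivative
      flat_exp (k + 2) x + - real k * flat_exp (k + 1) x) (at x)"
    using greater by (cases k)
      (auto intro!: derivative_eq_intros simp: flat_exp_def power2_eq_square field_simps,
       metis Suc_pred neq0_conv power_Suc)
  thus ?thesis
    by (rule has_field_derivative_transform_within_open[of _ _ _ "{0<..}"])
      (use greater in \<open>auto simp: flat_exp_def\<close>)
next
  case less
  have "((\<lambda>x. 0) has_real_derivative flat_exp (k + 2) x + - real k * flat_exp (k + 1) x) (at x)"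
    using less by (auto simp: flat_exp_def)
  thus ?thesis
    by (rule has_field_derivative_transform_within_open[of _ _ _ "{..<0}"])
      (use less in \<open>auto simp: flat_exp_def\<close>)
next
  case equal
  have "((\<lambda>h. (flat_exp k (0 + h) - flat_exp k 0) / h) \<longlongrightarrow> 0) (at 0)"
    using flat_exp_tendsto_0[of "Suc k"]
    by (rule Lim_transform_eventually) (auto simp: flat_exp_def intro!: always_eventually)
  thus ?thesis using equal by (simp add: DERIV_def flat_exp_def)
qed

lemma smooth_flat_exp: "smooth (flat_exp k)"
proof (rule smooth_function_ring[of "range flat_exp"])
  show "function_ring (range flat_exp) (flat_exp k)" by (rule function_ring.generator) simp
  fix g assume "g \<in> range flat_exp"
  then obtain j where j: "g = flat_exp j" by blast
  have "function_ring (range flat_exp) (\<lambda>x. flat_exp (j + 2) x + - real j * flat_exp (j + 1) x)"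
    by (intro function_ring.intros rangeI)
  thus "\<exists>g'. (\<forall>x. (g has_real_derivative g' x) (at x)) \<and> function_ring (range flat_exp) g'"
    unfolding j using flat_exp_DERIV by (intro exI conjI allI)
qed

lemma smooth_bump:
  obtains b where "smooth b" "\<And>x. b x \<ge> 0" "\<And>x. 0 < x \<Longrightarrow> x < 1 \<Longrightarrow> b x > 0"
    "\<And>x. x \<le> 0 \<or> x \<ge> 1 \<Longrightarrow> b x = 0"
proof
  show "smooth (\<lambda>x. flat_exp 0 x * flat_exp 0 (-1 * x + 1))"
    by (intro smooth_mult smooth_flat_exp smooth_affine)
qed (auto simp: flat_exp_def)

lemma smooth_step:
  obtains B where "smooth B" "\<And>x. x \<le> 0 \<Longrightarrow> B x = 0" "\<And>x. x \<ge> 1 \<Longrightarrow> B x = 1"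
    "\<And>x. 0 \<le> B x" "\<And>x. B x \<le> 1"
proof -
  obtain b where b: "smooth b" and nonneg: "\<And>x. b x \<ge> 0" and pos: "\<And>x. 0 < x \<Longrightarrow> x < 1 \<Longrightarrow> b x > 0"
    and zero: "\<And>x. x \<le> 0 \<or> x \<ge> 1 \<Longrightarrow> b x = 0"
    by (rule smooth_bump) (rule that)
  obtain G where G: "\<And>x. (G has_real_derivative b x) (at x)" "G 0 = 0"
    using continuous_antiderivative[OF smooth_continuous[OF b]] by blast
  have mono: "G x \<le> G y" if "x \<le> y" for x y
    by (rule DERIV_nonneg_imp_nondecreasing[OF that]) (use G nonneg in blast)
  have "G 0 < G 1"
    by (rule DERIV_pos_imp_increasing_open[of 0 1 G])
      (use G pos in \<open>auto intro!: continuous_on_subset[OF DERIV_continuous_on_UNIV[OF G(1)]]\<close>)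
  hence G1_pos: "G 1 > 0" using G(2) by simp
  have left: "G x = 0" if "x \<le> 0" for x
  proof -
    have "G 0 \<le> G x"
      by (rule DERIV_nonpos_imp_nonincreasing[OF that]) (use G(1) zero in fastforce)
    thus ?thesis using mono[OF that] G(2) by simp
  qed
  have right: "G x = G 1" if "x \<ge> 1" for x
  proof -
    have "G x \<le> G 1"
      by (rule DERIV_nonpos_imp_nonincreasing[OF that]) (use G(1) zero in fastforce)
    thus ?thesis using mono[OF that] by simp
  qed
  have bounds: "0 \<le> G x" "G x \<le> G 1" for x
    using mono[of 0 x] mono[of x 1] left[of x] right[of x] G(2) G1_pos by linarith+
  show ?thesis
  proof (rule that[of "\<lambda>x. G x * (1 / G 1)"])
    show "smooth (\<lambda>x. G x * (1 / G 1))"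
      by (intro smooth_mult smooth_const smooth_if_deriv_smooth[OF G(1) b])
    show "G x * (1 / G 1) = 0" if "x \<le> 0" for x using left[OF that] by simp
    show "G x * (1 / G 1) = 1" if "x \<ge> 1" for x using right[OF that] G1_pos by simp
    show "0 \<le> G x * (1 / G 1)" "G x * (1 / G 1) \<le> 1" for x
      using bounds[of x] G1_pos by auto
  qed
qed

section \<open>Density of test functions\<close>

lemma test_fun_smooth: "test_fun \<phi> \<Longrightarrow> smooth \<phi>"
  by (simp add: test_fun_def)

lemma test_fun_C1_compact: "test_fun \<phi> \<Longrightarrow> C1_compact \<phi> (deriv \<phi>)"
  unfolding C1_compact_def test_fun_def by (auto intro: smooth_DERIV smooth_deriv smooth_continuous)

lemma test_fun_deriv: "test_fun \<phi> \<Longrightarrow> test_fun (deriv \<phi>)"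
  using C1_compact_C0_deriv[OF test_fun_C1_compact, of \<phi>]
  unfolding test_fun_def C0_compact_def by (auto intro: smooth_deriv)

lemma test_fun_C0_compact: "test_fun \<phi> \<Longrightarrow> C0_compact \<phi>"
  using test_fun_C1_compact C1_compact_C0 by blast

lemma test_fun_mult_smooth:
  assumes "test_fun \<phi>" "smooth f"
  shows "test_fun (\<lambda>x. \<phi> x * f x)"
proof -
  obtain R where "\<forall>x. \<bar>x\<bar> > R \<longrightarrow> \<phi> x = 0" using assms(1) unfolding test_fun_def by blast
  thus ?thesis using assms unfolding test_fun_def by (auto intro: smooth_mult)
qed

lemma smooth_plateau:
  obtains \<eta> where "test_fun \<eta>" "\<And>x. 0 \<le> \<eta> x" "\<And>x. \<eta> x \<le> 1"
    "\<And>x. \<bar>x\<bar> \<le> 1 \<Longrightarrow> \<eta> x = 1" "\<And>x. \<bar>x\<bar> \<ge> 2 \<Longrightarrow> \<eta> x = 0"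
proof -
  obtain B where B: "smooth B" "\<And>x. x \<le> 0 \<Longrightarrow> B x = 0" "\<And>x. x \<ge> 1 \<Longrightarrow> B x = 1"
    "\<And>x. 0 \<le> B x" "\<And>x. B x \<le> 1"
    by (rule smooth_step) (rule that)
  define \<eta> where "\<eta> x = B (1 * x + 2) * B (-1 * x + 2)" for x
  show ?thesis
  proof
    show support: "\<eta> x = 0" if "\<bar>x\<bar> \<ge> 2" for x
      using that B(2) by (cases "x \<ge> 0") (auto simp: \<eta>_def)
    have "smooth \<eta>" unfolding \<eta>_def by (intro smooth_mult smooth_affine B)
    thus "test_fun \<eta>" unfolding test_fun_def using support by (auto intro!: exI[of _ 2])
    show "\<eta> x \<le> 1" for x unfolding \<eta>_def by (intro mult_le_one B)
  qed (auto simp: \<eta>_def B)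
qed

lemma cutoff_sequence:
  obtains cut :: "nat \<Rightarrow> real \<Rightarrow> real" and C where "\<And>n. test_fun (cut n)" "\<And>n x. \<bar>cut n x\<bar> \<le> 1"
    "\<And>n x. \<bar>deriv (cut n) x\<bar> \<le> C" "\<And>n x. \<bar>x\<bar> < real n \<Longrightarrow> cut n x = 1 \<and> deriv (cut n) x = 0"
    "\<And>n x. \<bar>x\<bar> > 2 * (real n + 1) \<Longrightarrow> cut n x = 0 \<and> deriv (cut n) x = 0"
proof -
  obtain \<eta> where \<eta>: "test_fun \<eta>" "\<And>x. 0 \<le> \<eta> x" "\<And>x. \<eta> x \<le> 1"
    and one: "\<And>x. \<bar>x\<bar> \<le> 1 \<Longrightarrow> \<eta> x = 1" and zero: "\<And>x. \<bar>x\<bar> \<ge> 2 \<Longrightarrow> \<eta> x = 0"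
    by (rule smooth_plateau) (rule that)
  obtain C where C: "\<And>x. \<bar>deriv \<eta> x\<bar> \<le> C"
    using C0_compact_bounded[OF test_fun_C0_compact[OF test_fun_deriv[OF \<eta>(1)]]] by blast
  define cut where "cut n x = \<eta> (1 / (real n + 1) * x + 0)" for n x
  have cut_inner: "cut n x = 1" if "\<bar>x\<bar> < real n" for n x
    using that by (auto simp: cut_def intro!: one)
  have cut_outer: "cut n x = 0" if "\<bar>x\<bar> > 2 * (real n + 1)" for n x
    using that by (auto simp: cut_def pos_le_divide_eq intro!: zero)
  have smooth: "smooth (cut n)" for n
    unfolding cut_def by (intro smooth_affine test_fun_smooth \<eta>)
  note deriv_eq_0 = DERIV_eq_0_if_constant_on_open[OF smooth_DERIV[OF smooth]]
  show ?thesis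
  proof (rule that[of cut C])
    show "test_fun (cut n)" for n
      using smooth cut_outer unfolding test_fun_def by blast
    show "\<bar>cut n x\<bar> \<le> 1" for n x using \<eta>(2,3) by (simp add: cut_def)
    show "\<bar>deriv (cut n) x\<bar> \<le> C" for n x
    proof -
      have "(cut n has_real_derivative
          deriv \<eta> (1 / (real n + 1) * x + 0) * (1 / (real n + 1))) (at x)"
        unfolding cut_def
        by (rule DERIV_chain2[OF smooth_DERIV])
          (auto intro!: derivative_eq_intros test_fun_smooth \<eta>)
      hence "\<bar>deriv (cut n) x\<bar> = \<bar>deriv \<eta> (1 / (real n + 1) * x + 0)\<bar> * (1 / (real n + 1))"
        by (simp add: DERIV_imp_deriv abs_mult)
      also have "\<dots> \<le> C * 1"
        using order_trans[OF abs_ge_zero C[of 0]] by (intro mult_mono C) auto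
      finally show ?thesis by simp
    qed
    have "open {x :: real. \<bar>x\<bar> < r}" "open {x :: real. \<bar>x\<bar> > r}" for r
      by (intro open_Collect_less continuous_intros)+
    note deriv_cut_eq_0 = deriv_eq_0[OF this(1)] deriv_eq_0[OF this(2)]
    show "cut n x = 1 \<and> deriv (cut n) x = 0" if "\<bar>x\<bar> < real n" for n x
      using deriv_cut_eq_0(1)[of x "real n" n 1] cut_inner that by simp
    show "cut n x = 0 \<and> deriv (cut n) x = 0" if "\<bar>x\<bar> > 2 * (real n + 1)" for n x
      using deriv_cut_eq_0(2)[of x "2 * (real n + 1)" n 0] cut_outer that by simp
  qed
qed

lemma smooth_C1_approximation:
  fixes \<psi> \<psi>' :: "real \<Rightarrow> real"
  assumes \<psi>: "\<And>x. (\<psi> has_real_derivative \<psi>' x) (at x)" "continuous_on UNIV \<psi>'"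
    and "e > 0" "R \<ge> 0"
  obtains P where "smooth P" "\<And>x. \<bar>x\<bar> \<le> R \<Longrightarrow> \<bar>P x - \<psi> x\<bar> \<le> e" "\<And>x. \<bar>x\<bar> \<le> R \<Longrightarrow> \<bar>deriv P x - \<psi>' x\<bar> \<le> e"
proof -
  define d where "d = e / (1 + R)"
  have d: "d > 0" "d \<le> e" "d * R \<le> e"
    using \<open>e > 0\<close> \<open>R \<ge> 0\<close> by (auto simp: d_def field_simps)
  obtain p where p: "real_polynomial_function p" "\<And>x. x \<in> {-R..R} \<Longrightarrow> \<bar>\<psi>' x - p x\<bar> < d"
    using Stone_Weierstrass_real_polynomial_function[OF compact_Icc
        continuous_on_subset[OF \<psi>(2) subset_UNIV] d(1)]
    by blast
  note smooth_p = smooth_real_polynomial_function[OF p(1)]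
  obtain P where P: "\<And>x. (P has_real_derivative p x) (at x)" "P 0 = \<psi> 0"
    using continuous_antiderivative[OF smooth_continuous[OF smooth_p]] by blast
  have deriv_close: "\<bar>p x - \<psi>' x\<bar> \<le> d" if "\<bar>x\<bar> \<le> R" for x
  proof -
    have "\<bar>\<psi>' x - p x\<bar> < d" using that by (intro p(2)) auto
    thus ?thesis by linarith
  qed
  have "\<bar>P x - \<psi> x\<bar> \<le> e" if "\<bar>x\<bar> \<le> R" for x
  proof -
    have "norm ((P x - \<psi> x) - (P 0 - \<psi> 0)) \<le> d * norm (x - 0)"
    proof (rule field_differentiable_bound[of "{-R..R}" "\<lambda>x. P x - \<psi> x" "\<lambda>x. p x - \<psi>' x"])
      show "((\<lambda>x. P x - \<psi> x) has_real_derivative p z - \<psi>' z) (at z within {-R..R})" for z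
        by (intro DERIV_diff has_field_derivative_at_within[OF P(1)]
            has_field_derivative_at_within[OF \<psi>(1)])
      show "norm (p z - \<psi>' z) \<le> d" if "z \<in> {-R..R}" for z using deriv_close[of z] that by auto
    qed (use that \<open>R \<ge> 0\<close> in auto)
    also have "\<dots> \<le> d * R" using that d(1) by (intro mult_left_mono) auto
    finally show ?thesis using d(3) P(2) by simp
  qed
  moreover have "deriv P x = p x" for x using P(1) by (rule DERIV_imp_deriv)
  ultimately show ?thesis
    using deriv_close d(2) by (intro that[OF smooth_if_deriv_smooth[OF P(1) smooth_p]]) force+
qed

lemma smooth_C1_approximation_sequence:
  fixes \<psi> \<psi>' :: "real \<Rightarrow> real" and R :: "nat \<Rightarrow> real"
  assumes \<psi>: "\<And>x. (\<psi> has_real_derivative \<psi>' x) (at x)" "continuous_on UNIV \<psi>'"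
    and R: "\<And>n. R n \<ge> 0"
  obtains P where "\<And>n. smooth (P n)"
    "\<And>n x. \<bar>x\<bar> \<le> R n \<Longrightarrow> \<bar>P n x - \<psi> x\<bar> \<le> 1 / (real n + 1)"
    "\<And>n x. \<bar>x\<bar> \<le> R n \<Longrightarrow> \<bar>deriv (P n) x - \<psi>' x\<bar> \<le> 1 / (real n + 1)"
proof -
  have "\<exists>P. smooth P \<and> (\<forall>x. \<bar>x\<bar> \<le> R n \<longrightarrow> \<bar>P x - \<psi> x\<bar> \<le> 1 / (real n + 1)) \<and>
      (\<forall>x. \<bar>x\<bar> \<le> R n \<longrightarrow> \<bar>deriv P x - \<psi>' x\<bar> \<le> 1 / (real n + 1))" for n
    by (rule smooth_C1_approximation[OF \<psi> _ R, of "1 / (real n + 1)" n]) auto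
  thus ?thesis using that by metis
qed

lemma cutoff_mult_bounds:
  assumes cut: "test_fun \<eta>" "\<bar>\<eta> x\<bar> \<le> 1" "\<bar>deriv \<eta> x\<bar> \<le> C" and P: "smooth P"
    and close: "\<eta> x = 0 \<and> deriv \<eta> x = 0 \<or> \<bar>P x\<bar> \<le> A \<and> \<bar>deriv P x\<bar> \<le> B" and "A \<ge> 0" "B \<ge> 0"
  shows "\<bar>\<eta> x * P x\<bar> \<le> A" "\<bar>deriv (\<lambda>x. \<eta> x * P x) x\<bar> \<le> C * A + B"
proof -
  have "C \<ge> 0" using cut(3) by linarith
  have bounds: "\<bar>\<eta> x * P x\<bar> \<le> 1 * A \<and> \<bar>deriv \<eta> x * P x\<bar> \<le> C * A \<and> \<bar>\<eta> x * deriv P x\<bar> \<le> 1 * B"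
  proof (cases "\<eta> x = 0 \<and> deriv \<eta> x = 0")
    case True
    thus ?thesis using \<open>A \<ge> 0\<close> \<open>B \<ge> 0\<close> \<open>C \<ge> 0\<close> by simp
  next
    case False
    hence "\<bar>P x\<bar> \<le> A" "\<bar>deriv P x\<bar> \<le> B" using close by auto
    thus ?thesis unfolding abs_mult using cut(2,3) \<open>C \<ge> 0\<close> by (intro conjI mult_mono) auto
  qed
  note deriv = smooth_deriv_mult[OF test_fun_smooth[OF cut(1)] P, of x]
  show "\<bar>\<eta> x * P x\<bar> \<le> A" "\<bar>deriv (\<lambda>x. \<eta> x * P x) x\<bar> \<le> C * A + B"
    unfolding deriv using bounds abs_triangle_ineq[of "deriv \<eta> x * P x" "\<eta> x * deriv P x"]
    by linarith+
qed

lemma tendsto_if_dist_le_inverse: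
  fixes f :: "nat \<Rightarrow> real"
  assumes "\<And>n. \<bar>x\<bar> < real n \<Longrightarrow> \<bar>f n - y\<bar> \<le> 1 / (real n + 1)"
  shows "f \<longlonglongrightarrow> y"
proof (rule LIM_zero_cancel, rule Lim_null_comparison)
  show "(\<lambda>n. 1 / (real n + 1)) \<longlonglongrightarrow> 0"
    using LIMSEQ_inverse_real_of_nat by (simp add: inverse_eq_divide add.commute)
  show "\<forall>\<^sub>F n in sequentially. norm (f n - y) \<le> 1 / (real n + 1)"
    using filterlim_real_sequentially[unfolded filterlim_at_top_dense, rule_format, of "\<bar>x\<bar>"]
    by eventually_elim (use assms in simp)
qed

lemma test_fun_C1_approximation:
  fixes \<psi> \<psi>' :: "real \<Rightarrow> real"
  assumes \<psi>: "\<And>x. (\<psi> has_real_derivative \<psi>' x) (at x)" "continuous_on UNIV \<psi>'"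
  obtains T :: "nat \<Rightarrow> real \<Rightarrow> real" and C where "\<And>n. test_fun (T n)"
    "\<And>x. (\<lambda>n. T n x) \<longlonglongrightarrow> \<psi> x" "\<And>x. (\<lambda>n. deriv (T n) x) \<longlonglongrightarrow> \<psi>' x"
    "\<And>n x. \<bar>T n x\<bar> \<le> \<bar>\<psi> x\<bar> + 1" "\<And>n x. \<bar>deriv (T n) x\<bar> \<le> C * (\<bar>\<psi> x\<bar> + 1) + (\<bar>\<psi>' x\<bar> + 1)"
proof -
  obtain cut :: "nat \<Rightarrow> real \<Rightarrow> real" and C
    where cut: "\<And>n. test_fun (cut n)" "\<And>n x. \<bar>cut n x\<bar> \<le> 1" "\<And>n x. \<bar>deriv (cut n) x\<bar> \<le> C"
      and inner: "\<And>n x. \<bar>x\<bar> < real n \<Longrightarrow> cut n x = 1 \<and> deriv (cut n) x = 0"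
      and outer: "\<And>n x. \<bar>x\<bar> > 2 * (real n + 1) \<Longrightarrow> cut n x = 0 \<and> deriv (cut n) x = 0"
    by (rule cutoff_sequence) (rule that)
  obtain P where P: "\<And>n. smooth (P n)"
    "\<And>n x. \<bar>x\<bar> \<le> 2 * (real n + 1) \<Longrightarrow> \<bar>P n x - \<psi> x\<bar> \<le> 1 / (real n + 1)"
    "\<And>n x. \<bar>x\<bar> \<le> 2 * (real n + 1) \<Longrightarrow> \<bar>deriv (P n) x - \<psi>' x\<bar> \<le> 1 / (real n + 1)"
    by (rule smooth_C1_approximation_sequence[OF \<psi>, of "\<lambda>n. 2 * (real n + 1)"]) (simp, rule that)
  define T where "T n = (\<lambda>x. cut n x * P n x)" for n
  have near: "\<bar>T n x - \<psi> x\<bar> \<le> 1 / (real n + 1)" "\<bar>deriv (T n) x - \<psi>' x\<bar> \<le> 1 / (real n + 1)"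
    if "\<bar>x\<bar> < real n" for n x
    using P(2,3)[of x n] inner[OF that] that
    by (auto simp: T_def smooth_deriv_mult[OF test_fun_smooth[OF cut(1)] P(1)])
  have close: "cut n x = 0 \<and> deriv (cut n) x = 0 \<or>
      \<bar>P n x\<bar> \<le> \<bar>\<psi> x\<bar> + 1 \<and> \<bar>deriv (P n) x\<bar> \<le> \<bar>\<psi>' x\<bar> + 1" for n x
  proof (cases "\<bar>x\<bar> > 2 * (real n + 1)")
    case False
    hence "\<bar>P n x - \<psi> x\<bar> \<le> 1" "\<bar>deriv (P n) x - \<psi>' x\<bar> \<le> 1"
      using order_trans[OF P(2)[of x n], of 1] order_trans[OF P(3)[of x n], of 1] by auto
    thus ?thesis by linarith
  qed (use outer in blast)
  show ?thesis
  proof (rule that[of T C])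
    show "test_fun (T n)" for n unfolding T_def by (intro test_fun_mult_smooth cut P)
    show "(\<lambda>n. T n x) \<longlonglongrightarrow> \<psi> x" "(\<lambda>n. deriv (T n) x) \<longlonglongrightarrow> \<psi>' x" for x
      by (rule tendsto_if_dist_le_inverse[OF near(1)] tendsto_if_dist_le_inverse[OF near(2)];
          assumption)+
    show "\<bar>T n x\<bar> \<le> \<bar>\<psi> x\<bar> + 1" "\<bar>deriv (T n) x\<bar> \<le> C * (\<bar>\<psi> x\<bar> + 1) + (\<bar>\<psi>' x\<bar> + 1)" for n x
      unfolding T_def by (intro cutoff_mult_bounds[OF cut P(1) close]; simp)+
  qed
qed

context finite_borel_measure
begin

lemma C0_compact_square_integrable:
  assumes "C0_compact f"
  shows "square_integrable M f"
proof -
  obtain C where "\<And>x. \<bar>f x\<bar> \<le> C" using C0_compact_bounded[OF assms] by blast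
  hence "\<bar>f x\<bar> \<le> \<bar>C\<bar>" for x by (meson abs_ge_self order_trans)
  moreover have "f \<in> borel_measurable M"
    using C0_compact_measurable[OF assms] by (simp add: measurable_cong_sets[OF M_is_borel refl])
  ultimately show ?thesis by (intro square_integrable_bound[OF square_integrable_const])
qed

lemma test_fun_square_integrable:
  assumes "test_fun \<phi>"
  shows "square_integrable M \<phi>" "square_integrable M (deriv \<phi>)"
  using assms by (auto intro: C0_compact_square_integrable test_fun_C0_compact test_fun_deriv)

definition C1_Sobolev :: "(real \<Rightarrow> real) \<Rightarrow> (real \<Rightarrow> real) \<Rightarrow> bool" where
  "C1_Sobolev \<psi> \<psi>' \<longleftrightarrow> (\<forall>x. (\<psi> has_real_derivative \<psi>' x) (at x)) \<and> continuous_on UNIV \<psi>' \<and>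
     square_integrable M \<psi> \<and> square_integrable M \<psi>'"

lemma C1_SobolevD:
  assumes "C1_Sobolev \<psi> \<psi>'"
  shows "(\<psi> has_real_derivative \<psi>' x) (at x)" "continuous_on UNIV \<psi>'"
    "square_integrable M \<psi>" "square_integrable M \<psi>'"
  using assms by (auto simp: C1_Sobolev_def)

lemma C1_Sobolev_affine: "C1_Sobolev \<psi> \<psi>' \<Longrightarrow> C1_Sobolev (\<lambda>x. a + b * \<psi> x) (\<lambda>x. b * \<psi>' x)"
  unfolding C1_Sobolev_def
  by (auto intro!: derivative_eq_intros continuous_intros square_integrable_const
      square_integrable_add square_integrable_cmult)

lemma test_fun_dense_C1_Sobolev:
  assumes \<psi>: "C1_Sobolev \<psi> \<psi>'"
  obtains T where "\<And>n. test_fun (T n)" "L2_tendsto M T \<psi>" "L2_tendsto M (\<lambda>n. deriv (T n)) \<psi>'"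
proof -
  obtain T :: "nat \<Rightarrow> real \<Rightarrow> real" and C where T: "\<And>n. test_fun (T n)"
    and lim: "\<And>x. (\<lambda>n. T n x) \<longlonglongrightarrow> \<psi> x" "\<And>x. (\<lambda>n. deriv (T n) x) \<longlonglongrightarrow> \<psi>' x"
    and bound: "\<And>n x. \<bar>T n x\<bar> \<le> \<bar>\<psi> x\<bar> + 1"
      "\<And>n x. \<bar>deriv (T n) x\<bar> \<le> C * (\<bar>\<psi> x\<bar> + 1) + (\<bar>\<psi>' x\<bar> + 1)"
    by (rule test_fun_C1_approximation[OF C1_SobolevD(1,2)[OF \<psi>]]) (rule that)
  have measurable: "T n \<in> borel_measurable M" "deriv (T n) \<in> borel_measurable M" for n
    using test_fun_square_integrable[OF T] square_integrable_measurable by auto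
  show ?thesis
  proof (rule that[OF T])
    show "L2_tendsto M T \<psi>"
      by (rule L2_tendsto_dominated[OF measurable(1) lim(1) bound(1)])
        (intro square_integrable_intros square_integrable_const C1_SobolevD[OF \<psi>])
    show "L2_tendsto M (\<lambda>n. deriv (T n)) \<psi>'"
      by (rule L2_tendsto_dominated[OF measurable(2) lim(2) bound(2)])
        (intro square_integrable_intros square_integrable_const C1_SobolevD[OF \<psi>])
  qed
qed

end

section \<open>The Gibbs measure and its max-min values\<close>

locale gibbs =
  fixes V :: "real \<Rightarrow> real"
  assumes smooth_V: "smooth V" and integrable_exp_V: "integrable lborel (\<lambda>x. exp (- V x))"
begin

definition rho :: "real \<Rightarrow> real" where
  "rho x = exp (- V x) / Zc V"

lemma Zc_pos: "Zc V > 0"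
proof -
  have "\<not> (AE x in lborel. exp (- V x) = 0)"
    using ae_filter_eq_bot_iff[of "lborel :: real measure"] by (simp add: eventually_False)
  hence "Zc V \<noteq> 0"
    using integral_nonneg_eq_0_iff_AE[OF integrable_exp_V] by (simp add: Zc_def)
  moreover have "Zc V \<ge> 0" unfolding Zc_def by simp
  ultimately show ?thesis by simp
qed

lemma rho_pos: "rho x > 0"
  using Zc_pos by (simp add: rho_def)

lemma rho_nonneg: "rho x \<ge> 0"
  using rho_pos by (rule less_imp_le)

lemma rho_nonzero[simp]: "rho x \<noteq> 0"
  using rho_pos[of x] by simp

lemma rho_DERIV: "(rho has_real_derivative - deriv V x * rho x) (at x)"
  unfolding rho_def using Zc_pos
  by (auto intro!: derivative_eq_intros smooth_DERIV[OF smooth_V])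

lemma rho_continuous: "continuous_on UNIV rho"
  using rho_DERIV by (rule DERIV_continuous_on_UNIV)

lemma deriv_V_continuous: "continuous_on UNIV (deriv V)"
  by (intro smooth_continuous smooth_deriv smooth_V)

lemma rho_measurable[measurable]: "rho \<in> borel_measurable borel"
  using rho_continuous by (rule borel_measurable_continuous_onI)

lemma rho_integrable: "integrable lborel rho"
  using integrable_exp_V unfolding rho_def by (intro integrable_divide_zero) auto

lemma LINT_rho: "(LINT x|lborel. rho x) = 1"
  using Zc_pos by (simp add: rho_def Zc_def[symmetric])

lemma mu_eq_density: "mu V = density lborel rho"
  by (simp add: mu_def rho_def)

sublocale mu: real_distribution "mu V"
proof (intro real_distribution.intro prob_spaceI real_distribution_axioms.intro)
  have "emeasure (mu V) (space (mu V)) = (\<integral>\<^sup>+x. rho x \<partial>lborel)"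
    by (simp add: mu_eq_density emeasure_density)
  also have "\<dots> = 1"
    using rho_integrable LINT_rho rho_nonneg by (simp add: nn_integral_eq_integral)
  finally show "emeasure (mu V) (space (mu V)) = 1" .
qed (simp add: mu_def)

sublocale mu: finite_borel_measure "mu V"
  by (rule mu.finite_borel_measure_M)

lemma prob_UNIV[simp]: "mu.prob UNIV = 1"
  using mu.prob_space by simp

lemma integrable_mu_iff:
  fixes f :: "real \<Rightarrow> real"
  assumes "f \<in> borel_measurable borel"
  shows "integrable (mu V) f \<longleftrightarrow> integrable lborel (\<lambda>x. rho x * f x)"
  unfolding mu_eq_density using assms rho_nonneg by (subst integrable_density) auto

lemma LINT_mu:
  fixes f :: "real \<Rightarrow> real"
  assumes "f \<in> borel_measurable borel"
  shows "(LINT x|mu V. f x) = (LINT x|lborel. rho x * f x)"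
  unfolding mu_eq_density using assms rho_nonneg by (subst integral_density) auto

lemma set_LINT_mu:
  fixes f :: "real \<Rightarrow> real"
  assumes [measurable]: "f \<in> borel_measurable borel" "S \<in> sets borel"
  shows "(LINT x:S|mu V. f x) = (LINT x:S|lborel. rho x * f x)"
  unfolding set_lebesgue_integral_def by (subst LINT_mu) (auto simp: mult.left_commute)

lemma AE_mu_iff: "(AE x in mu V. P x) \<longleftrightarrow> (AE x in lborel. P x)"
  unfolding mu_eq_density using rho_pos by (subst AE_density) auto

lemma L2_iff: "L2 V f \<longleftrightarrow> square_integrable (mu V) f"
  by (simp add: L2_def square_integrable_def measurable_cong_sets[OF mu.M_is_borel refl])

lemma C0_compact_Lop:
  assumes "test_fun \<phi>"
  shows "C0_compact (Lop V \<phi>)"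
  unfolding Lop_def using assms
  by (intro C0_compact_diff C0_compact_mult_left deriv_V_continuous test_fun_C0_compact
      test_fun_deriv)

lemma neg_Lop_square_integrable: "test_fun \<phi> \<Longrightarrow> square_integrable (mu V) (\<lambda>x. - Lop V \<phi> x)"
  using square_integrable_cmult[OF mu.C0_compact_square_integrable[OF C0_compact_Lop], of \<phi> "-1"]
  by simp

lemma graphE:
  assumes "graph V f g"
  obtains \<phi> where "\<And>n. test_fun (\<phi> n)" "L2_tendsto (mu V) \<phi> f"
    "L2_tendsto (mu V) (\<lambda>n x. - Lop V (\<phi> n) x) g"
proof -
  obtain \<phi> where \<phi>: "\<And>n. test_fun (\<phi> n)" "(\<lambda>n. LINT x|mu V. (\<phi> n x - f x)\<^sup>2) \<longlonglongrightarrow> 0"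
    "(\<lambda>n. LINT x|mu V. (- Lop V (\<phi> n) x - g x)\<^sup>2) \<longlonglongrightarrow> 0"
    and fg: "square_integrable (mu V) f" "square_integrable (mu V) g"
    using assms unfolding graph_def L2_iff by blast
  show ?thesis
    by (rule that[of \<phi>])
      (simp_all add: \<phi> fg L2_tendsto_def mu.test_fun_square_integrable neg_Lop_square_integrable)
qed

lemma graph_test_fun: "test_fun \<phi> \<Longrightarrow> graph V \<phi> (\<lambda>x. - Lop V \<phi> x)"
  unfolding graph_def L2_iff
  by (auto intro: mu.test_fun_square_integrable neg_Lop_square_integrable exI[of _ "\<lambda>_. \<phi>"])

lemma flux_C1_compact:
  assumes "test_fun \<phi>"
  shows "C1_compact (\<lambda>x. rho x * deriv \<phi> x) (\<lambda>x. rho x * Lop V \<phi> x)"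
proof -
  have "C1_compact (\<lambda>x. rho x * deriv \<phi> x)
    (\<lambda>x. - deriv V x * rho x * deriv \<phi> x + rho x * deriv (deriv \<phi>) x)"
    by (rule C1_compact_mult[OF test_fun_C1_compact[OF test_fun_deriv[OF assms]] rho_DERIV])
      (intro continuous_intros deriv_V_continuous rho_continuous)
  thus ?thesis by (simp add: Lop_def[abs_def] algebra_simps)
qed

lemma LINT_mult_Lop:
  assumes \<phi>: "test_fun \<phi>" and f: "\<And>x. (f has_real_derivative f' x) (at x)" "continuous_on UNIV f'"
  shows "(LINT x|mu V. f x * - Lop V \<phi> x) = (LINT x|mu V. f' x * deriv \<phi> x)"
proof -
  note f_continuous = DERIV_continuous_on_UNIV[OF f(1)]
  have compact: "C0_compact (\<lambda>x. f' x * deriv \<phi> x)" "C0_compact (\<lambda>x. f x * Lop V \<phi> x)"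
    by (intro C0_compact_mult_left C0_compact_Lop test_fun_C0_compact test_fun_deriv \<phi> f
        f_continuous)+
  have "0 = (LINT x|lborel. rho x * (f' x * deriv \<phi> x) + rho x * (f x * Lop V \<phi> x))"
    using LINT_deriv_compact[OF C1_compact_mult[OF flux_C1_compact[OF \<phi>] f]]
    by (simp add: mult.left_commute)
  also have "\<dots> = (LINT x|lborel. rho x * (f' x * deriv \<phi> x))
      + (LINT x|lborel. rho x * (f x * Lop V \<phi> x))"
    by (intro Bochner_Integration.integral_add C0_compact_integrable C0_compact_mult_left
        rho_continuous compact)
  also have "\<dots> = (LINT x|mu V. f' x * deriv \<phi> x) + (LINT x|mu V. f x * Lop V \<phi> x)"
    using compact[THEN C0_compact_measurable] by (simp add: LINT_mu)
  finally show ?thesis by simp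
qed

lemma LINT_test_fun_mult_Lop:
  assumes "test_fun \<phi>"
  shows "(LINT x|mu V. \<phi> x * - Lop V \<phi> x) = (LINT x|mu V. (deriv \<phi> x)\<^sup>2)"
  using LINT_mult_Lop[OF assms, of \<phi> "deriv \<phi>"] test_fun_C1_compact[OF assms]
  by (simp add: C1_compact_def power2_eq_square)

lemma test_fun_diff_scaled:
  assumes "test_fun \<phi>" "test_fun \<psi>"
  shows "test_fun (\<lambda>x. \<phi> x - c * \<psi> x)"
    and "deriv (\<lambda>x. \<phi> x - c * \<psi> x) = (\<lambda>x. deriv \<phi> x - c * deriv \<psi> x)"
proof -
  have "smooth (\<lambda>x. \<phi> x + (- c) * \<psi> x)"
    using assms by (intro smooth_add smooth_mult smooth_const test_fun_smooth)
  moreover have "C0_compact (\<lambda>x. \<phi> x - c * \<psi> x)"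
    using assms
    by (intro C0_compact_diff C0_compact_mult_left test_fun_C0_compact continuous_intros)
  ultimately show "test_fun (\<lambda>x. \<phi> x - c * \<psi> x)" by (simp add: test_fun_def C0_compact_def)
  show "deriv (\<lambda>x. \<phi> x - c * \<psi> x) = (\<lambda>x. deriv \<phi> x - c * deriv \<psi> x)"
    using assms
    by (intro ext DERIV_imp_deriv DERIV_diff DERIV_cmult smooth_DERIV test_fun_smooth)
qed

lemma difference_closed_deriv: "difference_closed (Collect test_fun) deriv"
  by (simp add: difference_closed_def test_fun_diff_scaled)

lemma difference_closed_Lop: "difference_closed (Collect test_fun) (\<lambda>\<phi> x. - Lop V \<phi> x)"
  by (simp add: difference_closed_def test_fun_diff_scaled test_fun_deriv Lop_def fun_eq_iff
      algebra_simps)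

lemma orthogonal_test_fun_approximation:
  fixes k :: nat
  assumes A: "difference_closed (Collect test_fun) A" and \<eta>: "\<And>n. test_fun (\<eta> n)"
    and lim: "L2_tendsto (mu V) \<eta> f" "L2_tendsto (mu V) (\<lambda>n. A (\<eta> n)) g"
    and b: "\<And>i. i < k \<Longrightarrow> square_integrable (mu V) (b i)" "\<And>i. i < k \<Longrightarrow> (LINT x|mu V. f x * b i x) = 0"
  obtains \<phi> where "\<And>n. test_fun (\<phi> n)" "\<And>n i. i < k \<Longrightarrow> (LINT x|mu V. \<phi> n x * b i x) = 0"
    "L2_tendsto (mu V) \<phi> f" "L2_tendsto (mu V) (\<lambda>n. A (\<phi> n)) g"
proof -
  have "\<exists>\<phi>. (\<forall>n. \<phi> n \<in> Collect test_fun) \<and> (\<forall>n. \<forall>i<k. (LINT x|mu V. \<phi> n x * b i x) = 0) \<and>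
      L2_tendsto (mu V) \<phi> f \<and> L2_tendsto (mu V) (\<lambda>n. A (\<phi> n)) g"
    by (rule orthogonal_approximation[OF A _ _ lim b])
      (simp_all add: \<eta> mu.test_fun_square_integrable)
  then obtain \<phi> where \<phi>: "\<forall>n. \<phi> n \<in> Collect test_fun" "\<forall>n. \<forall>i<k. (LINT x|mu V. \<phi> n x * b i x) = 0"
    "L2_tendsto (mu V) \<phi> f" "L2_tendsto (mu V) (\<lambda>n. A (\<phi> n)) g"
    by blast
  show ?thesis by (rule that[of \<phi>]) (use \<phi> in simp_all)
qed

definition energy_gap :: "nat \<Rightarrow> (nat \<Rightarrow> real \<Rightarrow> real) \<Rightarrow> real \<Rightarrow> bool" where
  "energy_gap k b c \<longleftrightarrow> (\<forall>i<k. square_integrable (mu V) (b i)) \<and>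
     (\<forall>\<phi>. test_fun \<phi> \<and> (\<forall>i<k. (LINT x|mu V. \<phi> x * b i x) = 0) \<longrightarrow>
       c * (LINT x|mu V. (\<phi> x)\<^sup>2) \<le> (LINT x|mu V. (deriv \<phi> x)\<^sup>2))"

lemma energy_gap_graph:
  assumes gap: "energy_gap k b c" and fg: "graph V f g"
    and orth: "\<And>i. i < k \<Longrightarrow> (LINT x|mu V. f x * b i x) = 0"
  shows "c * (LINT x|mu V. (f x)\<^sup>2) \<le> (LINT x|mu V. f x * g x)"
proof -
  have b: "\<And>i. i < k \<Longrightarrow> square_integrable (mu V) (b i)" using gap by (simp add: energy_gap_def)
  obtain \<eta> where \<eta>: "\<And>n. test_fun (\<eta> n)" "L2_tendsto (mu V) \<eta> f"
    "L2_tendsto (mu V) (\<lambda>n x. - Lop V (\<eta> n) x) g"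
    by (rule graphE[OF fg]) (rule that)
  obtain \<phi> where \<phi>: "\<And>n. test_fun (\<phi> n)" "\<And>n i. i < k \<Longrightarrow> (LINT x|mu V. \<phi> n x * b i x) = 0"
    "L2_tendsto (mu V) \<phi> f" "L2_tendsto (mu V) (\<lambda>n x. - Lop V (\<phi> n) x) g"
    by (rule orthogonal_test_fun_approximation[of _ \<eta> f g k b, OF difference_closed_Lop \<eta> b orth])
      (assumption | rule that)+
  show ?thesis
  proof (rule L2_tendsto_Rayleigh_le[OF \<phi>(3) L2_tendsto_LINT_mult[OF \<phi>(3,4)]])
    show "c * (LINT x|mu V. (\<phi> n x)\<^sup>2) \<le> (LINT x|mu V. \<phi> n x * - Lop V (\<phi> n) x)" for n
      unfolding LINT_test_fun_mult_Lop[OF \<phi>(1)] using gap \<phi>(1,2) by (simp add: energy_gap_def)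
  qed
qed

lemma energy_gap_C1_Sobolev:
  assumes gap: "energy_gap k b c" and \<psi>: "mu.C1_Sobolev \<psi> \<psi>'"
    and orth: "\<And>i. i < k \<Longrightarrow> (LINT x|mu V. \<psi> x * b i x) = 0"
  shows "c * (LINT x|mu V. (\<psi> x)\<^sup>2) \<le> (LINT x|mu V. (\<psi>' x)\<^sup>2)"
proof -
  have b: "\<And>i. i < k \<Longrightarrow> square_integrable (mu V) (b i)" using gap by (simp add: energy_gap_def)
  obtain T where T: "\<And>n. test_fun (T n)" "L2_tendsto (mu V) T \<psi>"
    "L2_tendsto (mu V) (\<lambda>n. deriv (T n)) \<psi>'"
    by (rule mu.test_fun_dense_C1_Sobolev[OF \<psi>]) (rule that)
  obtain \<phi> where \<phi>: "\<And>n. test_fun (\<phi> n)" "\<And>n i. i < k \<Longrightarrow> (LINT x|mu V. \<phi> n x * b i x) = 0"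
    "L2_tendsto (mu V) \<phi> \<psi>" "L2_tendsto (mu V) (\<lambda>n. deriv (\<phi> n)) \<psi>'"
    by (rule orthogonal_test_fun_approximation[of _ T \<psi> \<psi>' k b,
          OF difference_closed_deriv T b orth])
      (assumption | rule that)+
  show ?thesis
  proof (rule L2_tendsto_Rayleigh_le[OF \<phi>(3) L2_tendsto_LINT_power2[OF \<phi>(4)]])
    show "c * (LINT x|mu V. (\<phi> n x)\<^sup>2) \<le> (LINT x|mu V. (deriv (\<phi> n) x)\<^sup>2)" for n
      using gap \<phi>(1,2) by (simp add: energy_gap_def)
  qed
qed

definition Rayleigh_inf :: "nat \<Rightarrow> (nat \<Rightarrow> real \<Rightarrow> real) \<Rightarrow> ereal" where
  "Rayleigh_inf k b = (INF fg \<in> {(f, g). graph V f g \<and> (LINT x|mu V. (f x)\<^sup>2) > 0 \<and>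
       (\<forall>i<k. (LINT x|mu V. f x * b i x) = 0)}.
     ereal ((LINT x|mu V. fst fg x * snd fg x) / (LINT x|mu V. (fst fg x)\<^sup>2)))"

lemma lam_eq_SUP_Rayleigh_inf:
  "lam V k = (SUP b \<in> {b. \<forall>i<k. square_integrable (mu V) (b i)}. Rayleigh_inf k b)"
  by (simp add: lam_def Rayleigh_inf_def L2_iff)

theorem lam_ge_if_energy_gap:
  assumes gap: "energy_gap k b c"
  shows "lam V k \<ge> ereal c"
  unfolding lam_eq_SUP_Rayleigh_inf
proof (rule SUP_upper2)
  show "b \<in> {b. \<forall>i<k. square_integrable (mu V) (b i)}" using gap by (simp add: energy_gap_def)
  have "c \<le> (LINT x|mu V. f x * g x) / (LINT x|mu V. (f x)\<^sup>2)"
    if "graph V f g" "(LINT x|mu V. (f x)\<^sup>2) > 0" "\<forall>i<k. (LINT x|mu V. f x * b i x) = 0" for f g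
    using energy_gap_graph[OF gap that(1)] that(2,3) by (simp add: pos_le_divide_eq)
  thus "ereal c \<le> Rayleigh_inf k b"
    unfolding Rayleigh_inf_def by (intro INF_greatest) auto
qed

lemma less_lam_imp_energy_gap:
  assumes "ereal c < lam V k"
  obtains b where "energy_gap k b c"
proof -
  obtain b where b: "\<forall>i<k. square_integrable (mu V) (b i)" and less: "ereal c < Rayleigh_inf k b"
    using assms unfolding lam_eq_SUP_Rayleigh_inf less_SUP_iff by auto
  have "c * (LINT x|mu V. (\<phi> x)\<^sup>2) \<le> (LINT x|mu V. (deriv \<phi> x)\<^sup>2)"
    if \<phi>: "test_fun \<phi>" "\<forall>i<k. (LINT x|mu V. \<phi> x * b i x) = 0" for \<phi>
  proof (cases "(LINT x|mu V. (\<phi> x)\<^sup>2) > 0")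
    case True
    have "Rayleigh_inf k b \<le> ereal ((LINT x|mu V. \<phi> x * - Lop V \<phi> x) / (LINT x|mu V. (\<phi> x)\<^sup>2))"
      unfolding Rayleigh_inf_def using \<phi> True graph_test_fun[OF \<phi>(1)]
      by (auto intro!: INF_lower2[of "(\<phi>, \<lambda>x. - Lop V \<phi> x)"])
    with less have "c \<le> (LINT x|mu V. (deriv \<phi> x)\<^sup>2) / (LINT x|mu V. (\<phi> x)\<^sup>2)"
      unfolding LINT_test_fun_mult_Lop[OF \<phi>(1)]
      by (meson ereal_less_eq(3) less_imp_le less_le_trans)
    thus ?thesis using True by (simp add: pos_le_divide_eq)
  next
    case False
    hence "(LINT x|mu V. (\<phi> x)\<^sup>2) = 0" by (simp add: antisym not_less)
    thus ?thesis by simp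
  qed
  thus ?thesis using b by (intro that) (auto simp: energy_gap_def)
qed

text \<open>A single constraint is met by a nontrivial combination of the constant 1 and the centred \<open>\<psi>\<close>.\<close>

lemma Poincare_inequality_below:
  assumes c: "0 < c" "ereal c < lam V 1" and \<psi>: "mu.C1_Sobolev \<psi> \<psi>'"
  shows "c * mu.variance \<psi> \<le> (LINT x|mu V. (\<psi>' x)\<^sup>2)"
proof -
  define f where "f x = \<psi> x - mu.expectation \<psi>" for x
  have f: "mu.C1_Sobolev f \<psi>'"
    using mu.C1_Sobolev_affine[OF \<psi>, of "- mu.expectation \<psi>" 1] by (simp add: f_def[abs_def])
  note f_square = mu.C1_SobolevD(3)[OF f]
  have f_mean: "mu.expectation f = 0"
    unfolding f_def using mu.square_integrable_integrable[OF mu.C1_SobolevD(3)[OF \<psi>]] by simp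
  obtain b where gap: "energy_gap 1 b c" by (rule less_lam_imp_energy_gap[OF c(2)])
  hence b0: "square_integrable (mu V) (b 0)" by (simp add: energy_gap_def)
  define \<alpha> \<beta> where "\<alpha> = mu.expectation (b 0)" and "\<beta> = (LINT x|mu V. f x * b 0 x)"
  obtain r t where rt: "r \<noteq> 0 \<or> t \<noteq> 0" "r * \<alpha> + t * \<beta> = 0"
    using that[of 0 1] that[of \<beta> "- \<alpha>"] by (cases "\<beta> = 0") simp_all
  have "(LINT x|mu V. (r + t * f x) * b 0 x) = r * \<alpha> + t * \<beta>"
    using mu.square_integrable_integrable[OF b0] square_integrable_mult[OF f_square b0]
    by (simp add: \<alpha>_def \<beta>_def distrib_right mult.assoc)
  hence "c * (LINT x|mu V. (r + t * f x)\<^sup>2) \<le> (LINT x|mu V. (t * \<psi>' x)\<^sup>2)"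
    using rt(2) by (intro energy_gap_C1_Sobolev[OF gap mu.C1_Sobolev_affine[OF f]]) simp
  hence le: "c * (r\<^sup>2 + t\<^sup>2 * (LINT x|mu V. (f x)\<^sup>2)) \<le> t\<^sup>2 * (LINT x|mu V. (\<psi>' x)\<^sup>2)"
    using LINT_lincomb_power2[OF mu.square_integrable_const[of 1] f_square, of r t] f_mean
    by (simp add: power_mult_distrib)
  have "t \<noteq> 0" using le rt(1) c(1) by (auto simp: mult_le_0_iff)
  have "c * r\<^sup>2 \<ge> 0" using c(1) by simp
  with le have "t\<^sup>2 * (c * (LINT x|mu V. (f x)\<^sup>2)) \<le> t\<^sup>2 * (LINT x|mu V. (\<psi>' x)\<^sup>2)"
    by (simp add: algebra_simps)
  thus ?thesis using \<open>t \<noteq> 0\<close> by (simp add: f_def)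
qed

theorem Poincare_inequality:
  assumes l: "lam V 1 = ereal l" and \<psi>: "mu.C1_Sobolev \<psi> \<psi>'"
  shows "l * mu.variance \<psi> \<le> (LINT x|mu V. (\<psi>' x)\<^sup>2)"
proof (cases "l > 0")
  case True
  show ?thesis
  proof (rule field_le_mult_one_interval)
    fix z :: real assume "0 < z" "z < 1"
    hence "0 < z * l" "ereal (z * l) < lam V 1" using True l by auto
    from Poincare_inequality_below[OF this \<psi>]
    show "z * (l * mu.variance \<psi>) \<le> (LINT x|mu V. (\<psi>' x)\<^sup>2)" by (simp add: mult.assoc)
  qed
next
  case False
  hence "l * mu.variance \<psi> \<le> 0" by (simp add: mult_le_0_iff)
  also have "0 \<le> (LINT x|mu V. (\<psi>' x)\<^sup>2)" by simp
  finally show ?thesis .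
qed

end

section \<open>Regularity on the domain of the operator\<close>

lemma DERIV_LINT_atMost:
  assumes h: "integrable lborel h" "continuous_on UNIV h"
  shows "((\<lambda>x. LINT y:{..x}|lborel. h y) has_real_derivative h x) (at x)"
proof -
  define I where "I x = (LINT y:{..x}|lborel. h y)" for x
  obtain H where H: "\<And>x. (H has_real_derivative h x) (at x)" "H 0 = I 0"
    using continuous_antiderivative[OF h(2)] by blast
  have increment: "I b - I a = H b - H a" if "a \<le> b" for a b
  proof -
    have "set_integrable lborel S h" if "S \<in> sets borel" for S
      using integrable_mult_indicator[OF _ h(1), of S] that by (simp add: set_integrable_def)
    moreover have "{..b} = {..a} \<union> {a<..b}" "{..a} \<inter> {a<..b} = {}" using that by auto
    ultimately have "I b - I a = (LINT y:{a<..b}|lborel. h y)"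
      unfolding I_def by (simp add: set_integral_Un)
    also have "\<dots> = (LINT y:{a..b}|lborel. h y)"
      using interval_integral_Icc[OF that, of h] interval_integral_Ioc[OF that, of h] by simp
    also have "\<dots> = H b - H a" by (rule LINT_Icc_deriv[OF that H(1) h(2)])
    finally show ?thesis .
  qed
  have "I x = H x" for x
    using increment[of 0 x] increment[of x 0] H(2) by (cases "x \<ge> 0") auto
  thus ?thesis using H(1) unfolding I_def by presburger
qed

lemma increment_tendsto_if_deriv_uniform_limit:
  fixes \<phi> :: "nat \<Rightarrow> real \<Rightarrow> real"
  assumes \<phi>: "\<And>n x. (\<phi> n has_real_derivative \<phi>' n x) (at x)"
    and H: "\<And>x. (H has_real_derivative H' x) (at x)"
    and lim: "uniform_limit (closed_segment a b) \<phi>' H' sequentially"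
  shows "(\<lambda>n. \<phi> n b - \<phi> n a) \<longlonglongrightarrow> H b - H a"
proof (rule tendstoI)
  fix e :: real assume "e > 0"
  define d where "d = e / (\<bar>b - a\<bar> + 1)"
  have d: "d > 0" "d * \<bar>b - a\<bar> < e" using \<open>e > 0\<close> by (auto simp: d_def field_simps)
  have "\<forall>\<^sub>F n in sequentially. \<forall>t \<in> closed_segment a b. dist (\<phi>' n t) (H' t) < d"
    using uniform_limitD[OF lim d(1)] .
  thus "\<forall>\<^sub>F n in sequentially. dist (\<phi> n b - \<phi> n a) (H b - H a) < e"
  proof eventually_elim
    case (elim n)
    have "norm ((\<phi> n b - H b) - (\<phi> n a - H a)) \<le> d * norm (b - a)"
    proof (rule field_differentiable_bound[of "closed_segment a b" "\<lambda>t. \<phi> n t - H t"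
      "\<lambda>t. \<phi>' n t - H' t"])
      show "((\<lambda>t. \<phi> n t - H t) has_real_derivative
          \<phi>' n t - H' t) (at t within closed_segment a b)" for t
        by (intro DERIV_diff has_field_derivative_at_within[OF \<phi>]
            has_field_derivative_at_within[OF H])
      show "norm (\<phi>' n t - H' t) \<le> d" if "t \<in> closed_segment a b" for t
        using elim that by (auto simp: dist_norm intro: less_imp_le)
    qed auto
    thus ?case using d(2) by (simp add: dist_norm algebra_simps)
  qed
qed

lemma AE_limit_C1_representative:
  fixes \<phi> :: "nat \<Rightarrow> real \<Rightarrow> real"
  assumes \<phi>: "\<And>n x. (\<phi> n has_real_derivative \<phi>' n x) (at x)"
    and uniform: "\<And>K. compact K \<Longrightarrow> uniform_limit K \<phi>' F' sequentially" and "continuous_on UNIV F'"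
    and r: "strict_mono r" and ae: "AE x in M. (\<lambda>n. \<phi> (r n) x) \<longlonglongrightarrow> f x" and "ae_filter M \<noteq> bot"
  obtains F where "\<And>x. (F has_real_derivative F' x) (at x)" "AE x in M. f x = F x"
proof -
  obtain a where a: "(\<lambda>n. \<phi> (r n) a) \<longlonglongrightarrow> f a"
    using eventually_happens'[OF \<open>ae_filter M \<noteq> bot\<close> ae] by blast
  obtain F where F: "\<And>x. (F has_real_derivative F' x) (at x)" "F a = f a"
    using continuous_antiderivative[OF \<open>continuous_on UNIV F'\<close>] by blast
  have lim: "(\<lambda>n. \<phi> (r n) x) \<longlonglongrightarrow> F x" for x
  proof -
    have "(\<lambda>n. \<phi> n x - \<phi> n a) \<longlonglongrightarrow> F x - F a"
      by (intro increment_tendsto_if_deriv_uniform_limit[OF \<phi> F(1)] uniform compact_segment)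
    from tendsto_add[OF LIMSEQ_subseq_LIMSEQ[OF this r] a] show ?thesis by (simp add: o_def F(2))
  qed
  have "AE x in M. f x = F x"
    using ae by eventually_elim (rule LIMSEQ_unique[OF _ lim])
  thus ?thesis by (rule that[OF F(1)])
qed

lemma square_integrable_cong_AE:
  assumes "AE x in M. f x = g x" "f \<in> borel_measurable M" "g \<in> borel_measurable M"
  shows "square_integrable M f \<longleftrightarrow> square_integrable M g"
proof -
  have "integrable M (\<lambda>x. (f x)\<^sup>2) \<longleftrightarrow> integrable M (\<lambda>x. (g x)\<^sup>2)"
    using assms by (intro integrable_cong_AE) auto
  thus ?thesis using assms by (simp add: square_integrable_def)
qed

context gibbs
begin

lemma flux_error_le:
  assumes \<phi>: "test_fun \<phi>" and g: "square_integrable (mu V) g"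
  shows "\<bar>rho x * deriv \<phi> x - - (LINT y:{..x}|mu V. g y)\<bar>
      \<le> sqrt (LINT y|mu V. (- Lop V \<phi> y - g y)\<^sup>2)"
proof -
  note Lop = C0_compact_Lop[OF \<phi>]
  note integrable = mu.square_integrable_integrable[OF square_integrable_indicator_mult]
  have indicator_square: "square_integrable (mu V) (indicator {..x})"
    using square_integrable_indicator_mult[OF mu.square_integrable_const[of 1], of "{..x}"] by simp
  have "rho x * deriv \<phi> x = (LINT y:{..x}|mu V. Lop V \<phi> y)"
    using LINT_atMost_deriv_compact[OF flux_C1_compact[OF \<phi>]] C0_compact_measurable[OF Lop]
    by (simp add: set_LINT_mu)
  hence "rho x * deriv \<phi> x - - (LINT y:{..x}|mu V. g y) =
      (LINT y|mu V. indicator {..x} y * Lop V \<phi> y + indicator {..x} y * g y)"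
    using integrable[OF mu.C0_compact_square_integrable[OF Lop]] integrable[OF g]
    by (simp add: set_lebesgue_integral_def)
  also have "\<dots> = - (LINT y|mu V. indicator {..x} y * (- Lop V \<phi> y - g y))"
    by (subst Bochner_Integration.integral_minus[symmetric]) (simp add: algebra_simps)
  finally have "\<bar>rho x * deriv \<phi> x - - (LINT y:{..x}|mu V. g y)\<bar> =
      \<bar>LINT y|mu V. indicator {..x} y * (- Lop V \<phi> y - g y)\<bar>" by simp
  also have "\<dots> \<le> sqrt (LINT y|mu V. (indicator {..x} y)\<^sup>2)
      * sqrt (LINT y|mu V. (- Lop V \<phi> y - g y)\<^sup>2)"
    by (intro LINT_Cauchy_Schwarz indicator_square square_integrable_diff neg_Lop_square_integrable
        \<phi> g)
  also have "(LINT y|mu V. (indicator {..x} y)\<^sup>2) = mu.prob {..x}"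
    by (simp add: power2_eq_square indicator_inter_arith[symmetric])
  also have "sqrt (mu.prob {..x}) * sqrt (LINT y|mu V. (- Lop V \<phi> y - g y)\<^sup>2)
      \<le> 1 * sqrt (LINT y|mu V. (- Lop V \<phi> y - g y)\<^sup>2)"
    by (intro mult_right_mono) auto
  finally show ?thesis by simp
qed

definition graph_deriv :: "(real \<Rightarrow> real) \<Rightarrow> real \<Rightarrow> real" where
  "graph_deriv g x = - (LINT y:{..x}|mu V. g y) / rho x"

lemma flux_uniform_limit:
  assumes \<phi>: "\<And>n. test_fun (\<phi> n)" and lim: "L2_tendsto (mu V) (\<lambda>n x. - Lop V (\<phi> n) x) g"
  shows "uniform_limit UNIV (\<lambda>n x. rho x * deriv (\<phi> n) x)
    (\<lambda>x. - (LINT y:{..x}|mu V. g y)) sequentially"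
proof (rule uniform_limitI)
  fix e :: real assume "e > 0"
  have "(\<lambda>n. sqrt (LINT y|mu V. (- Lop V (\<phi> n) y - g y)\<^sup>2)) \<longlonglongrightarrow> 0"
    using tendsto_real_sqrt[OF L2_tendstoD(3)[OF lim]] by simp
  from order_tendstoD(2)[OF this \<open>e > 0\<close>]
  show "\<forall>\<^sub>F n in sequentially. \<forall>x\<in>UNIV. dist (rho x * deriv (\<phi> n) x)
    (- (LINT y:{..x}|mu V. g y)) < e"
  proof eventually_elim
    case (elim n)
    thus ?case using flux_error_le[OF \<phi>[of n] L2_tendstoD(2)[OF lim]]
      by (auto simp: dist_real_def intro: le_less_trans)
  qed
qed

lemma
  assumes \<phi>: "\<And>n. test_fun (\<phi> n)" and lim: "L2_tendsto (mu V) (\<lambda>n x. - Lop V (\<phi> n) x) g"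
  shows graph_deriv_continuous: "continuous_on UNIV (graph_deriv g)"
    and deriv_uniform_limit: "compact K \<Longrightarrow> uniform_limit K (\<lambda>n. deriv (\<phi> n))
      (graph_deriv g) sequentially"
proof -
  define G where "G x = - (LINT y:{..x}|mu V. g y)" for x
  have graph_deriv: "graph_deriv g = (\<lambda>x. G x * inverse (rho x))"
    by (simp add: graph_deriv_def G_def divide_inverse fun_eq_iff)
  have flux: "uniform_limit UNIV (\<lambda>n x. rho x * deriv (\<phi> n) x) G sequentially"
    unfolding G_def by (rule flux_uniform_limit[OF \<phi> lim])
  have "continuous_on UNIV (\<lambda>x. rho x * deriv (\<phi> n) x)" for n
    by (intro continuous_on_mult rho_continuous smooth_continuous smooth_deriv test_fun_smooth \<phi>)
  hence G: "continuous_on S G" for S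
    using uniform_limit_theorem[OF _ flux] by (auto intro: continuous_on_subset)
  have inverse: "continuous_on S (\<lambda>x. inverse (rho x))" for S
    using continuous_on_subset[OF rho_continuous] by (intro continuous_on_inverse) auto
  show "continuous_on UNIV (graph_deriv g)"
    unfolding graph_deriv by (intro continuous_on_mult G inverse)
  assume "compact K"
  hence "uniform_limit K (\<lambda>n x. (rho x * deriv (\<phi> n) x) * inverse (rho x))
    (graph_deriv g) sequentially"
    unfolding graph_deriv
    by (intro uniform_lim_mult uniform_limit_on_subset[OF flux] uniform_limit_const
        compact_imp_bounded compact_continuous_image G inverse) auto
  moreover have "(rho x * deriv (\<phi> n) x) * inverse (rho x) = deriv (\<phi> n) x" for n x by simp
  ultimately show "uniform_limit K (\<lambda>n. deriv (\<phi> n)) (graph_deriv g) sequentially" by simp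
qed

lemma graph_C1_representative:
  assumes fg: "graph V f g"
  obtains F where "mu.C1_Sobolev F (graph_deriv g)" "AE x in mu V. f x = F x"
proof -
  obtain \<phi> where \<phi>: "\<And>n. test_fun (\<phi> n)" and lim_f: "L2_tendsto (mu V) \<phi> f"
    and lim_g: "L2_tendsto (mu V) (\<lambda>n x. - Lop V (\<phi> n) x) g"
    by (rule graphE[OF fg]) (rule that)
  note continuous = graph_deriv_continuous[OF \<phi> lim_g] and uniform = deriv_uniform_limit[OF \<phi> lim_g]
  obtain r where r: "strict_mono r" and ae: "AE x in mu V. (\<lambda>n. \<phi> (r n) x) \<longlonglongrightarrow> f x"
    by (rule L2_tendsto_AE_subseq[OF lim_f]) (rule that)
  obtain F where F: "\<And>x. (F has_real_derivative graph_deriv g x) (at x)"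
    and f_eq_F: "AE x in mu V. f x = F x"
    by (rule AE_limit_C1_representative[OF smooth_DERIV[OF test_fun_smooth[OF \<phi>]]
          uniform continuous r ae mu.ae_filter_bot])
      (assumption | rule that)+
  have F_square: "square_integrable (mu V) F"
    using square_integrable_cong_AE[OF f_eq_F] L2_tendstoD(2)[OF lim_f]
      borel_measurable_continuous_onI[OF DERIV_continuous_on_UNIV[OF F]] by simp
  have "(\<lambda>n. LINT x|mu V. (deriv (\<phi> n) x)\<^sup>2) \<longlonglongrightarrow> (LINT x|mu V. f x * g x)"
    using L2_tendsto_LINT_mult[OF lim_f lim_g] by (simp only: LINT_test_fun_mult_Lop[OF \<phi>])
  hence "Bseq (\<lambda>n. LINT x|mu V. (deriv (\<phi> n) x)\<^sup>2)" by (intro convergent_imp_Bseq convergentI)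
  then obtain C where C: "\<forall>n. norm (LINT x|mu V. (deriv (\<phi> n) x)\<^sup>2) \<le> C" by (rule BseqE)
  have "integrable (mu V) (\<lambda>x. (graph_deriv g x)\<^sup>2)"
  proof (rule Fatou_integrable)
    show "integrable (mu V) (\<lambda>x. (deriv (\<phi> n) x)\<^sup>2)" for n
      by (intro square_integrable_power2 mu.test_fun_square_integrable \<phi>)
    show "(\<lambda>n. (deriv (\<phi> n) x)\<^sup>2) \<longlonglongrightarrow> (graph_deriv g x)\<^sup>2" for x
      using tendsto_uniform_limitI[OF uniform[of "{x}"]] by (intro tendsto_power) auto
    show "(LINT x|mu V. (deriv (\<phi> n) x)\<^sup>2) \<le> C" for n using C by simp
  qed simp
  hence "square_integrable (mu V) (graph_deriv g)"
    using borel_measurable_continuous_onI[OF continuous] by (simp add: square_integrable_def)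
  hence "mu.C1_Sobolev F (graph_deriv g)"
    using F continuous F_square by (simp add: mu.C1_Sobolev_def)
  thus ?thesis using f_eq_F by (rule that)
qed

definition eigenpair :: "real \<Rightarrow> (real \<Rightarrow> real) \<Rightarrow> (real \<Rightarrow> real) \<Rightarrow> bool" where
  "eigenpair l F F' \<longleftrightarrow> mu.C1_Sobolev F F' \<and>
     (\<forall>x. (F' has_real_derivative deriv V x * F' x - l * F x) (at x))"

lemma eigfun_imp_eigenpair:
  assumes "eigfun V l f" "(LINT x|mu V. (f x)\<^sup>2) > 0"
  obtains F F' where "eigenpair l F F'" "(LINT x|mu V. (F x)\<^sup>2) > 0"
proof -
  obtain g where fg: "graph V f g" and g: "AE x in mu V. g x = l * f x"
    using assms(1) unfolding eigfun_def by blast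
  obtain F where F: "mu.C1_Sobolev F (graph_deriv g)" and f_eq_F: "AE x in mu V. f x = F x"
    by (rule graph_C1_representative[OF fg]) (rule that)
  define F' where "F' = graph_deriv g"
  note F_square = mu.C1_SobolevD(3)[OF F]
    and F_continuous = DERIV_continuous_on_UNIV[OF mu.C1_SobolevD(1)[OF F]]
  have [measurable]: "f \<in> borel_measurable borel" "g \<in> borel_measurable borel"
    "F \<in> borel_measurable borel"
    using fg borel_measurable_continuous_onI[OF F_continuous] by (auto simp: graph_def L2_def)
  have g_eq: "AE x in mu V. g x = l * F x" using g f_eq_F by eventually_elim simp
  have "(LINT x|mu V. (F x)\<^sup>2) = (LINT x|mu V. (f x)\<^sup>2)"
    using f_eq_F by (intro integral_cong_AE) auto
  hence pos: "(LINT x|mu V. (F x)\<^sup>2) > 0" using assms(2) by simp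
  have flux_F: "rho x * F' x = - l * (LINT y:{..x}|lborel. rho y * F y)" for x
  proof -
    have "(LINT y:{..x}|mu V. g y) = (LINT y:{..x}|mu V. l * F y)"
      using g_eq by (intro set_lebesgue_integral_cong_AE) auto
    thus ?thesis by (simp add: F'_def graph_deriv_def set_LINT_mu)
  qed
  have "integrable lborel (\<lambda>x. rho x * F x)"
    using mu.square_integrable_integrable[OF F_square] by (simp add: integrable_mu_iff)
  hence "((\<lambda>x. rho x * F' x) has_real_derivative - l * (rho x * F x)) (at x)" for x
    unfolding flux_F
    by (intro DERIV_cmult DERIV_LINT_atMost continuous_intros rho_continuous F_continuous)
  from DERIV_divide[OF this rho_DERIV rho_nonzero]
  have "(F' has_real_derivative
      (- l * (rho x * F x) * rho x - rho x * F' x * (- deriv V x * rho x)) / (rho x * rho x)) (at x)"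
    for x
    by simp
  moreover have "(- l * (rho x * F x) * rho x - rho x * F' x * (- deriv V x * rho x)) / (rho x * rho x)
      = deriv V x * F' x - l * F x" for x
    by (simp add: field_simps)
  ultimately have "eigenpair l F F'" using F by (simp add: eigenpair_def F'_def)
  thus ?thesis using pos by (rule that)
qed

end

section \<open>Eigenfunctions for the first max-min value have no critical points\<close>

lemma Gronwall_zero_right:
  fixes E E' :: "real \<Rightarrow> real"
  assumes E: "\<And>t. (E has_real_derivative E' t) (at t)" and "a \<le> b"
    and bound: "\<And>t. a \<le> t \<Longrightarrow> t \<le> b \<Longrightarrow> E' t \<le> K * E t" and "E a = 0"
  shows "E b \<le> 0"
proof -
  have "exp (- K * b) * E b \<le> exp (- K * a) * E a"
  proof (rule DERIV_nonpos_imp_nonincreasing[OF \<open>a \<le> b\<close>, of "\<lambda>t. exp (- K * t) * E t"])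
    fix t assume "a \<le> t" "t \<le> b"
    hence "exp (- K * t) * (E' t - K * E t) \<le> 0" using bound[of t] by (simp add: mult_le_0_iff)
    moreover have "((\<lambda>t. exp (- K * t) * E t) has_real_derivative
        exp (- K * t) * (E' t - K * E t)) (at t)"
      by (auto intro!: derivative_eq_intros E simp: algebra_simps)
    ultimately show "\<exists>d. ((\<lambda>t. exp (- K * t) * E t) has_real_derivative d) (at t) \<and> d \<le> 0" by blast
  qed
  thus ?thesis using \<open>E a = 0\<close> by (simp add: mult_le_0_iff)
qed

lemma Gronwall_zero:
  fixes E E' :: "real \<Rightarrow> real"
  assumes E: "\<And>t. (E has_real_derivative E' t) (at t)"
    and bound: "\<And>t. t \<in> closed_segment a b \<Longrightarrow> \<bar>E' t\<bar> \<le> K * E t" and "E a = 0"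
  shows "E b \<le> 0"
proof (cases "a \<le> b")
  case True
  thus ?thesis
    using bound \<open>E a = 0\<close>
    by (intro Gronwall_zero_right[OF E, of a b K])
      (auto simp: closed_segment_eq_real_ivl abs_le_iff)
next
  case False
  have "E (- (- b)) \<le> 0"
  proof (rule Gronwall_zero_right[OF DERIV_reflect[OF E]])
    show "- E' (- t) \<le> K * E (- t)" if "- a \<le> t" "t \<le> - b" for t
      using bound[of "- t"] False that by (simp add: closed_segment_eq_real_ivl abs_le_iff)
  qed (use False \<open>E a = 0\<close> in auto)
  thus ?thesis by simp
qed

lemma linear_ode2_unique_zero:
  fixes F F' a b :: "real \<Rightarrow> real"
  assumes F: "\<And>x. (F has_real_derivative F' x) (at x)"
    and F': "\<And>x. (F' has_real_derivative a x * F' x + b x * F x) (at x)"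
    and coeff: "continuous_on UNIV a" "continuous_on UNIV b" and zero: "F x0 = 0" "F' x0 = 0"
  shows "F x = 0"
proof -
  define E where "E t = (F t)\<^sup>2 + (F' t)\<^sup>2" for t
  define E' where "E' t = (1 + b t) * (2 * F t * F' t) + 2 * a t * (F' t)\<^sup>2" for t
  have E: "(E has_real_derivative E' t) (at t)" for t
    unfolding E_def E'_def
    by (auto intro!: derivative_eq_intros F F' simp: power2_eq_square algebra_simps)
  have "compact ((\<lambda>t. 1 + \<bar>b t\<bar> + 2 * \<bar>a t\<bar>) ` closed_segment x0 x)"
    using coeff
    by (intro compact_continuous_image continuous_intros) (auto intro: continuous_on_subset)
  then obtain K where K: "\<forall>t \<in> closed_segment x0 x. 1 + \<bar>b t\<bar> + 2 * \<bar>a t\<bar> \<le> K"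
    by (auto dest!: compact_imp_bounded simp: bounded_real)
  have "E x \<le> 0"
  proof (rule Gronwall_zero[OF E])
    fix t assume "t \<in> closed_segment x0 x"
    hence K_ge: "1 + \<bar>b t\<bar> + 2 * \<bar>a t\<bar> \<le> K" using K by blast
    have "\<bar>2 * F t * F' t\<bar> \<le> E t"
      using sum_squares_bound[of "\<bar>F t\<bar>" "\<bar>F' t\<bar>"] by (simp add: E_def abs_mult)
    moreover have "(F' t)\<^sup>2 \<le> E t" by (simp add: E_def)
    ultimately have "\<bar>1 + b t\<bar> * \<bar>2 * F t * F' t\<bar> + 2 * \<bar>a t\<bar> * (F' t)\<^sup>2
        \<le> \<bar>1 + b t\<bar> * E t + 2 * \<bar>a t\<bar> * E t"
      by (intro add_mono mult_left_mono) auto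
    also have "\<dots> = (\<bar>1 + b t\<bar> + 2 * \<bar>a t\<bar>) * E t" by (simp add: distrib_right)
    also have "\<dots> \<le> K * E t" using K_ge by (intro mult_right_mono) (auto simp: E_def)
    finally show "\<bar>E' t\<bar> \<le> K * E t"
      unfolding E'_def by (intro order_trans[OF abs_triangle_ineq]) (simp add: abs_mult)
  qed (simp add: E_def zero)
  thus ?thesis by (simp add: E_def sum_power2_le_zero_iff)
qed

lemma DERIV_max_critical:
  fixes F F' :: "real \<Rightarrow> real"
  assumes F: "\<And>y. (F has_real_derivative F' y) (at y)" and critical: "F' x = 0"
  shows "((\<lambda>y. F (max y x)) has_real_derivative F' (max y x)) (at y)"
proof (cases y x rule: linorder_cases)
  case less
  have "((\<lambda>y. F x) has_real_derivative F' (max y x)) (at y)" using less critical by simp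
  thus ?thesis
    by (rule has_field_derivative_transform_within_open[of _ _ _ "{..<x}"]) (use less in auto)
next
  case greater
  have "(F has_real_derivative F' (max y x)) (at y)" using F[of y] greater by simp
  thus ?thesis
    by (rule has_field_derivative_transform_within_open[of _ _ _ "{x<..}"]) (use greater in auto)
next
  case equal
  have "((\<lambda>h. (F (x + h) - F x) / h) \<longlongrightarrow> 0) (at 0)" using F[of x] critical by (simp add: DERIV_def)
  hence "((\<lambda>h. (F (max (x + h) x) - F (max x x)) / h) \<longlongrightarrow> 0) (at 0)"
    by (rule Lim_null_comparison[rotated, OF tendsto_norm_zero])
      (auto intro!: always_eventually simp: max_def divide_le_0_iff)
  thus ?thesis using equal critical by (simp add: DERIV_def)
qed

context gibbs
begin

lemma eigenpairD:
  assumes "eigenpair l F F'"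
  shows "mu.C1_Sobolev F F'" "(F has_real_derivative F' x) (at x)"
    "(F' has_real_derivative deriv V x * F' x - l * F x) (at x)"
  using assms by (auto simp: eigenpair_def mu.C1_Sobolev_def)

lemma eigenpair_Green_test_fun:
  assumes F: "eigenpair l F F'" and critical: "F' x = 0" and \<phi>: "test_fun \<phi>"
  shows "(LINT y|mu V. (indicator {x..} y * F' y) * deriv \<phi> y)
      = (LINT y|mu V. (indicator {x..} y * (l * F y)) * \<phi> y)"
proof -
  have flux: "((\<lambda>y. rho y * F' y) has_real_derivative - (rho y * (l * F y))) (at y)" for y
    using DERIV_mult[OF rho_DERIV eigenpairD(3)[OF F], of y] by (simp add: algebra_simps)
  have "C1_compact (\<lambda>y. rho y * F' y * \<phi> y)
    (\<lambda>y. - (rho y * (l * F y)) * \<phi> y + rho y * F' y * deriv \<phi> y)"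
    by (rule C1_compact_mult[OF test_fun_C1_compact[OF \<phi>] flux])
      (intro continuous_intros rho_continuous DERIV_continuous_on_UNIV[OF eigenpairD(2)[OF F]])
  from LINT_atLeast_deriv_compact[OF this, of x]
  have "0 = (LINT y:{x..}|lborel. rho y * (F' y * deriv \<phi> y - l * F y * \<phi> y))"
    using critical by (simp add: algebra_simps)
  also have "\<dots> = (LINT y:{x..}|mu V. F' y * deriv \<phi> y - l * F y * \<phi> y)"
    using mu.C1_SobolevD(3,4)[OF eigenpairD(1)[OF F], THEN square_integrable_measurable]
      mu.test_fun_square_integrable[OF \<phi>, THEN square_integrable_measurable]
    by (simp add: set_LINT_mu)
  also have "\<dots> = (LINT y|mu V. (indicator {x..} y * F' y) * deriv \<phi> y
      - (indicator {x..} y * (l * F y)) * \<phi> y)"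
    by (simp add: set_lebesgue_integral_def algebra_simps)
  also have "\<dots> = (LINT y|mu V. (indicator {x..} y * F' y) * deriv \<phi> y)
      - (LINT y|mu V. (indicator {x..} y * (l * F y)) * \<phi> y)"
    by (intro Bochner_Integration.integral_diff square_integrable_mult
        square_integrable_indicator_mult square_integrable_cmult
        mu.C1_SobolevD[OF eigenpairD(1)[OF F]] mu.test_fun_square_integrable \<phi>) auto
  finally show ?thesis by simp
qed

lemma eigenpair_Green:
  assumes F: "eigenpair l F F'" and critical: "F' x = 0" and \<psi>: "mu.C1_Sobolev \<psi> \<psi>'"
  shows "(LINT y:{x..}|mu V. F' y * \<psi>' y) = l * (LINT y:{x..}|mu V. F y * \<psi> y)"
proof -
  obtain T where T: "\<And>n. test_fun (T n)"
    and lim: "L2_tendsto (mu V) T \<psi>" "L2_tendsto (mu V) (\<lambda>n. deriv (T n)) \<psi>'"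
    by (rule mu.test_fun_dense_C1_Sobolev[OF \<psi>]) (rule that)
  have square: "square_integrable (mu V) (\<lambda>y. indicator {x..} y * F' y)"
    "square_integrable (mu V) (\<lambda>y. indicator {x..} y * (l * F y))"
    by (intro square_integrable_indicator_mult square_integrable_cmult
        mu.C1_SobolevD[OF eigenpairD(1)[OF F]]; simp)+
  have "(\<lambda>n. LINT y|mu V. (indicator {x..} y * (l * F y)) * T n y)
      \<longlonglongrightarrow> (LINT y|mu V. (indicator {x..} y * F' y) * \<psi>' y)"
    using L2_tendsto_LINT_mult[OF L2_tendsto_const[OF square(1)] lim(2)]
    by (simp only: eigenpair_Green_test_fun[OF F critical T])
  moreover note L2_tendsto_LINT_mult[OF L2_tendsto_const[OF square(2)] lim(1)]
  ultimately have "(LINT y|mu V. (indicator {x..} y * F' y) * \<psi>' y)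
      = (LINT y|mu V. (indicator {x..} y * (l * F y)) * \<psi> y)"
    by (rule LIMSEQ_unique)
  also have "\<dots> = (LINT y|mu V. l * (indicator {x..} y * (F y * \<psi> y)))"
    by (simp add: mult_ac)
  finally show ?thesis by (simp add: set_lebesgue_integral_def mult.assoc)
qed

lemma
  assumes h: "integrable (mu V) h"
  shows integrable_max: "integrable (mu V) (\<lambda>y. h (max y x))"
    and expectation_max: "mu.expectation (\<lambda>y. h (max y x)) = (LINT y:{x..}|mu V. h y) + h x * mu.prob {..<x}"
proof -
  have split: "h (max y x) = indicator {x..} y *\<^sub>R h y + indicator {..<x} y *\<^sub>R h x" for y
    by (auto simp: max_def split: split_indicator)
  have integrable: "integrable (mu V) (\<lambda>y. indicator {x..} y *\<^sub>R h y)"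
    "integrable (mu V) (\<lambda>y. indicator {..<x} y *\<^sub>R h x)"
    by (intro integrable_mult_indicator h mu.integrable_const; simp)+
  show "integrable (mu V) (\<lambda>y. h (max y x))" unfolding split using integrable by simp
  show "mu.expectation (\<lambda>y. h (max y x)) = (LINT y:{x..}|mu V. h y) + h x * mu.prob {..<x}"
    unfolding split using integrable by (simp add: set_lebesgue_integral_def)
qed

lemma C1_Sobolev_max_critical:
  assumes F: "mu.C1_Sobolev F F'" and critical: "F' x = 0"
  shows "mu.C1_Sobolev (\<lambda>y. F (max y x)) (\<lambda>y. F' (max y x))"
proof -
  have square: "square_integrable (mu V) (\<lambda>y. h (max y x))" if "square_integrable (mu V) h" for h
    using integrable_max[OF square_integrable_power2[OF that]]
      square_integrable_measurable[OF that]
    by (auto simp: square_integrable_def)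
  have "continuous_on UNIV (\<lambda>y. F' (max y x))"
    by (intro continuous_on_compose2[OF mu.C1_SobolevD(2)[OF F]] continuous_intros) auto
  thus ?thesis
    unfolding mu.C1_Sobolev_def
    using DERIV_max_critical[OF mu.C1_SobolevD(1)[OF F] critical] square mu.C1_SobolevD(3,4)[OF F]
    by blast
qed

lemma prob_pos:
  assumes "a < b" "{a<..<b} \<subseteq> S" "S \<in> sets borel"
  shows "mu.prob S > 0"
proof (rule ccontr)
  assume "\<not> mu.prob S > 0"
  hence "mu.prob S = 0" using measure_nonneg[of "mu V" S] by linarith
  hence "AE x in mu V. x \<notin> S" using assms(3) mu.prob_eq_0[of S] by simp
  hence "AE x in lborel. x \<notin> {a<..<b}"
    unfolding AE_mu_iff by (rule eventually_mono) (use assms(2) in auto)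
  hence "emeasure lborel {a<..<b} = 0" by (subst (asm) AE_iff_measurable[of "{a<..<b}"]) auto
  thus False using assms(1) by simp
qed

text \<open>Freezing the eigenfunction to the left of a critical point \<open>x\<close> gives a competitor that
  violates the Poincare inequality, unless the eigenfunction vanishes at \<open>x\<close> too.\<close>

lemma eigenpair_critical_imp_zero:
  assumes lam: "lam V 1 = ereal l" and "l > 0" and F: "eigenpair l F F'" and critical: "F' x = 0"
  shows "F x = 0"
proof -
  define m N where "m = mu.prob {..<x}" and "N = (LINT y:{x..}|mu V. (F y)\<^sup>2)"
  note S = eigenpairD(1)[OF F]
  note square = mu.C1_SobolevD(3,4)[OF S]
  have frozen: "mu.C1_Sobolev (\<lambda>y. F (max y x)) (\<lambda>y. F' (max y x))"
    by (rule C1_Sobolev_max_critical[OF S critical])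
  have one: "mu.C1_Sobolev (\<lambda>_. 1) (\<lambda>_. 0)"
    by (simp add: mu.C1_Sobolev_def mu.square_integrable_const)
  have "(LINT y:{x..}|mu V. F y) = 0"
    using eigenpair_Green[OF F critical one] \<open>l > 0\<close> by simp
  hence mean: "mu.expectation (\<lambda>y. F (max y x)) = F x * m"
    using expectation_max[OF mu.square_integrable_integrable[OF square(1)]] by (simp add: m_def)
  have "mu.expectation (\<lambda>y. (F (max y x))\<^sup>2) = N + (F x)\<^sup>2 * m"
    using expectation_max[OF square_integrable_power2[OF square(1)]] by (simp add: m_def N_def)
  hence variance: "mu.variance (\<lambda>y. F (max y x)) = N + (F x)\<^sup>2 * m - (F x * m)\<^sup>2"
    using mu.C1_SobolevD(3)[OF frozen] mean
    by (subst mu.variance_eq) (auto intro: mu.square_integrable_integrable square_integrable_power2)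
  have "mu.expectation (\<lambda>y. (F' (max y x))\<^sup>2) = (LINT y:{x..}|mu V. (F' y)\<^sup>2)"
    using expectation_max[OF square_integrable_power2[OF square(2)]] critical by simp
  also have "\<dots> = l * N"
    using eigenpair_Green[OF F critical S] by (simp add: N_def power2_eq_square)
  finally have "l * (N + (F x)\<^sup>2 * m - (F x * m)\<^sup>2) \<le> l * N"
    using Poincare_inequality[OF lam frozen] by (simp only: variance)
  hence "(F x)\<^sup>2 * (m * (1 - m)) \<le> 0"
    using \<open>l > 0\<close> by (simp add: power2_eq_square algebra_simps)
  moreover have "m > 0" unfolding m_def by (rule prob_pos[of "x - 1" x]) auto
  moreover have "1 - m = mu.prob {x..}"
    unfolding m_def using mu.prob_compl[of "{..<x}"] by (simp add: Compl_eq_Diff_UNIV[symmetric])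
  moreover have "mu.prob {x..} > 0" by (rule prob_pos[of x "x + 1"]) auto
  ultimately show ?thesis by (simp add: mult_le_0_iff)
qed

lemma eigenpair_deriv_nonzero:
  assumes lam: "lam V 1 = ereal l" and "l > 0" and F: "eigenpair l F F'"
    and "(LINT x|mu V. (F x)\<^sup>2) > 0"
  shows "F' x \<noteq> 0"
proof
  assume critical: "F' x = 0"
  note zero = eigenpair_critical_imp_zero[OF lam \<open>l > 0\<close> F critical]
  have "F y = 0" for y
  proof (rule linear_ode2_unique_zero[OF eigenpairD(2)[OF F] _ deriv_V_continuous _ zero critical])
    show "(F' has_real_derivative deriv V z * F' z + - l * F z) (at z)" for z
      using eigenpairD(3)[OF F] by simp
  qed simp
  thus False using assms(4) by simp
qed

end

section \<open>Supersymmetric partners\<close>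

definition schroedinger_form :: "(real \<Rightarrow> real) \<Rightarrow> (real \<Rightarrow> real) \<Rightarrow> (real \<Rightarrow> real) \<Rightarrow> real" where
  "schroedinger_form W v v' = (LINT x|lborel. (v' x)\<^sup>2 + W x * (v x)\<^sup>2)"

lemma schroedinger_form_integrable:
  assumes "C1_compact v v'" "continuous_on UNIV W"
  shows "integrable lborel (\<lambda>x. (v' x)\<^sup>2 + W x * (v x)\<^sup>2)"
  using C1_compact_C0[OF assms(1)] C1_compact_C0_deriv[OF assms(1)] assms(2)
  by (intro C0_compact_integrable C0_compact_add C0_compact_mult_left C0_compact_power2)

lemma schroedinger_form_mono:
  assumes v: "C1_compact v v'" and W: "continuous_on UNIV W" "continuous_on UNIV U" "\<And>x. W x \<le> U x"
  shows "schroedinger_form W v v' \<le> schroedinger_form U v v'"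
  unfolding schroedinger_form_def
  by (intro integral_mono schroedinger_form_integrable v W add_left_mono mult_right_mono) simp

lemma schroedinger_form_add_const:
  assumes v: "C1_compact v v'" and W: "continuous_on UNIV W"
  shows "schroedinger_form (\<lambda>x. W x + c) v v'
      = schroedinger_form W v v' + c * (LINT x|lborel. (v x)\<^sup>2)"
proof -
  have "integrable lborel (\<lambda>x. c * (v x)\<^sup>2)"
    by (intro C0_compact_integrable C0_compact_mult_left C0_compact_power2 C1_compact_C0[OF v]
        continuous_intros)
  from Bochner_Integration.integral_add[OF schroedinger_form_integrable[OF v W] this]
  show ?thesis by (simp add: schroedinger_form_def distrib_right add.assoc)
qed

lemma LINT_factorized_form:
  assumes v: "C1_compact v v'"
    and a: "\<And>x. (a has_real_derivative a' x) (at x)" "continuous_on UNIV a'"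
  shows "(LINT x|lborel. (v' x - a x * v x)\<^sup>2) = schroedinger_form (\<lambda>x. a' x + (a x)\<^sup>2) v v'"
proof -
  note a_continuous = DERIV_continuous_on_UNIV[OF a(1)]
  have "C1_compact (\<lambda>x. v x * v x) (\<lambda>x. v' x * v x + v x * v' x)"
    using v C1_compact_mult[OF v, of v v'] by (simp add: C1_compact_def)
  note av2 = C1_compact_mult[OF this a]
  have form: "integrable lborel (\<lambda>x. (v' x)\<^sup>2 + (a' x + (a x)\<^sup>2) * (v x)\<^sup>2)"
    by (intro schroedinger_form_integrable v continuous_intros a a_continuous)
  have "(LINT x|lborel. (v' x - a x * v x)\<^sup>2) =
      (LINT x|lborel. ((v' x)\<^sup>2 + (a' x + (a x)\<^sup>2) * (v x)\<^sup>2)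
        - (a' x * (v x * v x) + a x * (v' x * v x + v x * v' x)))"
    by (rule Bochner_Integration.integral_cong) (auto simp: power2_eq_square algebra_simps)
  also have "\<dots> = schroedinger_form (\<lambda>x. a' x + (a x)\<^sup>2) v v'"
    using LINT_deriv_compact[OF av2] C0_compact_integrable[OF C1_compact_C0_deriv[OF av2]] form
    by (simp add: schroedinger_form_def)
  finally show ?thesis .
qed

lemma partner_exists:
  assumes h: "C0_compact h" and s: "\<And>x. (s has_real_derivative - r x * s x) (at x)" "\<And>x. s x \<noteq> 0"
    and r: "continuous_on UNIV r" and mean: "(LINT x|lborel. h x * (s x)\<^sup>2) = 0"
  obtains w w' where "C1_compact w w'" "\<And>x. w' x - r x * w x = h x * s x"
proof -
  note s_continuous = DERIV_continuous_on_UNIV[OF s(1)]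
  have "C0_compact (\<lambda>x. h x * (s x)\<^sup>2)"
    using h s_continuous by (intro C0_compact_mult_right continuous_intros)
  then obtain T where T: "C1_compact T (\<lambda>x. h x * (s x)\<^sup>2)"
    using C1_compact_antiderivative mean by blast
  have "((\<lambda>x. inverse (s x)) has_real_derivative r x * inverse (s x)) (at x)" for x
    using s by (auto intro!: derivative_eq_intros simp: power2_eq_square)
  hence "C1_compact (\<lambda>x. inverse (s x) * T x)
      (\<lambda>x. (r x * inverse (s x)) * T x + inverse (s x) * (h x * (s x)\<^sup>2))"
    using s(2) by (intro C1_compact_mult[OF T] continuous_intros r s_continuous) auto
  thus ?thesis by (rule that) (use s(2) in \<open>auto simp: power2_eq_square\<close>)
qed

lemma partner_flux:
  assumes w: "C1_compact w w'" and s: "\<And>x. (s has_real_derivative - r x * s x) (at x)"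
    and r: "continuous_on UNIV r" and partner: "\<And>x. w' x - r x * w x = g x"
  shows "C1_compact (\<lambda>x. s x * w x) (\<lambda>x. s x * g x)"
proof -
  have "C1_compact (\<lambda>x. s x * w x) (\<lambda>x. - r x * s x * w x + s x * w' x)"
    by (rule C1_compact_mult[OF w s]) (intro continuous_intros r DERIV_continuous_on_UNIV[OF s])
  moreover have "- r x * s x * w x + s x * w' x = s x * g x" for x
    unfolding partner[symmetric] by (simp add: algebra_simps)
  ultimately show ?thesis by simp
qed

text \<open>Integration by parts gives \<open>\<integral> h' s w = - \<integral> (h s)\<^sup>2\<close>; expand \<open>\<integral> (h' s + c w)\<^sup>2 \<ge> 0\<close>.\<close>

lemma partner_gap:
  assumes h: "C1_compact h h'" and w: "C1_compact w w'"
    and s: "\<And>x. (s has_real_derivative - r x * s x) (at x)" and r: "continuous_on UNIV r"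
    and partner: "\<And>x. w' x - r x * w x = h x * s x"
    and "c > 0" and le: "c * (LINT x|lborel. (w x)\<^sup>2) \<le> (LINT x|lborel. (w' x - r x * w x)\<^sup>2)"
  shows "c * (LINT x|lborel. (h x * s x)\<^sup>2) \<le> (LINT x|lborel. (h' x * s x)\<^sup>2)"
proof -
  define A B where "A = (LINT x|lborel. (h' x * s x)\<^sup>2)" and "B = (LINT x|lborel. (h x * s x)\<^sup>2)"
  note s_continuous = DERIV_continuous_on_UNIV[OF s]
  note compact = C1_compact_C0[OF h] C1_compact_C0_deriv[OF h] C1_compact_C0[OF w]
  have integrable: "integrable lborel (\<lambda>x. (h' x * s x)\<^sup>2)" "integrable lborel (\<lambda>x. (h x * s x)\<^sup>2)"
    "integrable lborel (\<lambda>x. h' x * s x * w x)" "integrable lborel (\<lambda>x. (w x)\<^sup>2)"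
    by (intro C0_compact_integrable C0_compact_power2 C0_compact_mult_right s_continuous
        C0_compact_continuous compact)+
  have "C1_compact (\<lambda>x. h x * (s x * w x)) (\<lambda>x. h' x * (s x * w x) + h x * (s x * (h x * s x)))"
    using h
    by (intro C1_compact_mult[OF partner_flux[OF w s r partner]]) (auto simp: C1_compact_def)
  from LINT_deriv_compact[OF this]
  have "(LINT x|lborel. h' x * s x * w x + (h x * s x)\<^sup>2) = 0"
    by (simp add: power2_eq_square mult_ac)
  hence parts: "(LINT x|lborel. h' x * s x * w x) = - B"
    using integrable by (simp add: B_def)
  have "0 \<le> (LINT x|lborel. (h' x * s x + c * w x)\<^sup>2)" by simp
  also have "\<dots> = (LINT x|lborel. (h' x * s x)\<^sup>2 + 2 * c * (h' x * s x * w x) + c\<^sup>2 * (w x)\<^sup>2)"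
    by (rule Bochner_Integration.integral_cong) (auto simp: power2_eq_square algebra_simps)
  also have "\<dots> = A - 2 * c * B + c * (c * (LINT x|lborel. (w x)\<^sup>2))"
    using integrable parts by (simp add: A_def power2_eq_square)
  also have "\<dots> \<le> A - 2 * c * B + c * B"
    using le \<open>c > 0\<close> unfolding partner B_def by (intro add_left_mono mult_left_mono) auto
  finally show ?thesis by (simp add: A_def B_def)
qed

lemma ground_state_gap:
  fixes u p p' :: "real \<Rightarrow> real"
  assumes v: "C1_compact v v'" and u: "\<And>x. (u has_real_derivative - p x * u x) (at x)" "\<And>x. u x \<noteq> 0"
    and p: "\<And>x. (p has_real_derivative p' x) (at x)" "continuous_on UNIV p'"
    and k: "k > 0" "\<And>x. p' x \<ge> k" and orth: "(LINT x|lborel. u x * v x) = 0"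
  shows "2 * k * (LINT x|lborel. (v x)\<^sup>2) \<le> (LINT x|lborel. (v' x + p x * v x)\<^sup>2)"
proof -
  note p_continuous = DERIV_continuous_on_UNIV[OF p(1)]
    and u_continuous = DERIV_continuous_on_UNIV[OF u(1)]
  define h where "h x = inverse (u x) * v x" for x
  define h' where "h' x = (p x * inverse (u x)) * v x + inverse (u x) * v' x" for x
  have "((\<lambda>x. inverse (u x)) has_real_derivative p x * inverse (u x)) (at x)" for x
    using u by (auto intro!: derivative_eq_intros simp: power2_eq_square)
  hence h: "C1_compact h h'"
    unfolding h_def h'_def using u(2)
    by (intro C1_compact_mult[OF v] continuous_intros p_continuous u_continuous) auto
  have hu: "h x * u x = v x" and h'u: "h' x * u x = v' x + p x * v x" for x
    using u(2)[of x] by (simp_all add: h_def h'_def field_simps)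
  have "h x * (u x)\<^sup>2 = u x * v x" for x
    unfolding hu[symmetric] by (simp add: power2_eq_square)
  then obtain w w' where w: "C1_compact w w'" and partner: "\<And>x. w' x - p x * w x = h x * u x"
    using partner_exists[OF C1_compact_C0[OF h] u p_continuous] orth by auto
  have minus_p: "((\<lambda>x. - p x) has_real_derivative - p' x) (at x)" for x by (intro DERIV_minus p)
  have "2 * k * (LINT x|lborel. (w x)\<^sup>2)
      \<le> (LINT x|lborel. (w' x - (- p x) * w x)\<^sup>2) + 2 * k * (LINT x|lborel. (w x)\<^sup>2)"
    by simp
  also have "\<dots> = schroedinger_form (\<lambda>x. - p' x + (- p x)\<^sup>2 + 2 * k) w w'"
    unfolding LINT_factorized_form[OF w minus_p continuous_on_minus[OF p(2)]]
    by (intro schroedinger_form_add_const[symmetric] w continuous_intros p p_continuous)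
  also have "\<dots> \<le> schroedinger_form (\<lambda>x. p' x + (p x)\<^sup>2) w w'"
    using k(2)
    by (intro schroedinger_form_mono w continuous_intros p p_continuous) (smt (verit) power2_minus)
  also have "\<dots> = (LINT x|lborel. (w' x - p x * w x)\<^sup>2)"
    by (rule LINT_factorized_form[OF w p, symmetric])
  finally show ?thesis
    using partner_gap[OF h w u(1) p_continuous partner, of "2 * k"] k(1) by (simp add: hu h'u)
qed

context gibbs
begin

definition pot :: "real \<Rightarrow> real" where
  "pot x = deriv (deriv V) x / 2 + (deriv V x)\<^sup>2 / 4"

lemma smooth_pot: "smooth pot"
proof -
  have "smooth (\<lambda>x. deriv (deriv V) x * (1 / 2) + deriv V x * deriv V x * (1 / 4))"
    by (intro smooth_add smooth_mult smooth_const smooth_deriv smooth_V)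
  thus ?thesis by (simp add: pot_def[abs_def] power2_eq_square)
qed

lemma half_deriv_V_DERIV: "((\<lambda>x. deriv V x / 2) has_real_derivative deriv (deriv V) x / 2) (at x)"
  by (intro DERIV_cdivide smooth_DERIV smooth_deriv smooth_V)

lemma half_deriv_V_continuous: "continuous_on UNIV (\<lambda>x. deriv V x / 2)"
  by (intro continuous_intros deriv_V_continuous) simp

lemma sqrt_rho_DERIV:
  "((\<lambda>x. sqrt (rho x)) has_real_derivative - (deriv V x / 2) * sqrt (rho x)) (at x)"
proof -
  have "((\<lambda>x. sqrt (rho x)) has_real_derivative
      inverse (sqrt (rho x)) / 2 * (- deriv V x * rho x)) (at x)"
    by (rule DERIV_chain2[OF DERIV_real_sqrt[OF rho_pos] rho_DERIV])
  moreover have "inverse (sqrt (rho x)) / 2 * (- deriv V x * rho x)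
      = - (deriv V x / 2) * sqrt (rho x)"
    using real_sqrt_mult_self[of "rho x"] rho_pos[of x] by (simp add: field_simps)
  ultimately show ?thesis by metis
qed

lemma pot_form:
  assumes "C1_compact v v'"
  shows "(LINT x|lborel. (v' x - deriv V x / 2 * v x)\<^sup>2) = schroedinger_form pot v v'"
proof -
  have "continuous_on UNIV (\<lambda>x. deriv (deriv V) x / 2)"
    by (intro continuous_intros smooth_continuous smooth_deriv smooth_V) simp
  from LINT_factorized_form[OF assms half_deriv_V_DERIV this] show ?thesis
    by (simp add: pot_def[abs_def] power_divide)
qed

lemma LINT_mu_power2:
  assumes "C0_compact f"
  shows "(LINT x|mu V. (f x)\<^sup>2) = (LINT x|lborel. (f x * sqrt (rho x))\<^sup>2)"
  using C0_compact_measurable[OF C0_compact_power2[OF assms]]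
  by (subst LINT_mu) (auto simp: power_mult_distrib rho_nonneg mult.commute)

text \<open>The constraint \<open>\<phi> \<perp> 1\<close> makes \<open>v = \<rho>\<^bsup>-1/2\<^esup> \<integral> \<phi> \<rho>\<close> compactly supported.\<close>

lemma lam_ge_if_form_ge:
  assumes b: "\<And>i. i < k \<Longrightarrow> square_integrable (mu V) (b i)" and "k > 0" "b 0 = (\<lambda>_. 1)" and "c > 0"
    and form_ge: "\<And>\<phi> v v'. test_fun \<phi> \<Longrightarrow> \<forall>i<k. (LINT x|mu V. \<phi> x * b i x) = 0 \<Longrightarrow> C1_compact v v' \<Longrightarrow>
      C1_compact (\<lambda>x. sqrt (rho x) * v x) (\<lambda>x. rho x * \<phi> x) \<Longrightarrow>
      c * (LINT x|lborel. (v x)\<^sup>2) \<le> schroedinger_form pot v v'"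
  shows "lam V k \<ge> ereal c"
proof -
  have "c * (LINT x|mu V. (\<phi> x)\<^sup>2) \<le> (LINT x|mu V. (deriv \<phi> x)\<^sup>2)"
    if \<phi>: "test_fun \<phi>" and orth: "\<forall>i<k. (LINT x|mu V. \<phi> x * b i x) = 0" for \<phi>
  proof -
    note compact = test_fun_C0_compact[OF \<phi>] test_fun_C0_compact[OF test_fun_deriv[OF \<phi>]]
    have "(LINT x|lborel. \<phi> x * (sqrt (rho x))\<^sup>2) = (LINT x|mu V. \<phi> x)"
      using C0_compact_measurable[OF compact(1)] by (simp add: LINT_mu rho_nonneg mult.commute)
    also have "\<dots> = 0" using orth[rule_format, of 0] \<open>k > 0\<close> \<open>b 0 = (\<lambda>_. 1)\<close> by simp
    finally obtain v v' where v: "C1_compact v v'"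
      and partner: "\<And>x. v' x - deriv V x / 2 * v x = \<phi> x * sqrt (rho x)"
      by (rule partner_exists[OF compact(1) sqrt_rho_DERIV _ half_deriv_V_continuous, rotated])
        (auto intro: that)
    have "sqrt (rho x) * (\<phi> x * sqrt (rho x)) = rho x * \<phi> x" for x
      using rho_nonneg[of x] by (simp add: mult.left_commute[of _ "\<phi> x"] mult.commute[of "\<phi> x"])
    hence "C1_compact (\<lambda>x. sqrt (rho x) * v x) (\<lambda>x. rho x * \<phi> x)"
      using partner_flux[OF v sqrt_rho_DERIV half_deriv_V_continuous partner] by (simp only:)
    hence "c * (LINT x|lborel. (v x)\<^sup>2) \<le> (LINT x|lborel. (v' x - deriv V x / 2 * v x)\<^sup>2)"
      unfolding pot_form[OF v] by (rule form_ge[OF \<phi> orth v])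
    from partner_gap[OF test_fun_C1_compact[OF \<phi>] v sqrt_rho_DERIV half_deriv_V_continuous partner
        \<open>c > 0\<close> this]
    show ?thesis by (simp only: LINT_mu_power2 compact)
  qed
  hence "energy_gap k b c" using b by (simp add: energy_gap_def)
  thus ?thesis by (rule lam_ge_if_energy_gap)
qed

section \<open>Positivity of the first max-min value\<close>

lemma rho_mult_power2_le_form:
  assumes v: "C1_compact v v'"
  shows "rho x * (v x)\<^sup>2 \<le> schroedinger_form pot v v'"
proof -
  define g where "g y = v' y - deriv V y / 2 * v y" for y
  have g: "C0_compact g"
    unfolding g_def by (intro C0_compact_diff C0_compact_mult_left half_deriv_V_continuous
        C1_compact_C0[OF v] C1_compact_C0_deriv[OF v])
  have flux: "C1_compact (\<lambda>y. sqrt (rho y) * v y) (\<lambda>y. sqrt (rho y) * g y)"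
    by (rule partner_flux[OF v sqrt_rho_DERIV half_deriv_V_continuous]) (simp add: g_def)
  have square: "square_integrable lborel (\<lambda>y. sqrt (rho y))" "square_integrable lborel g"
    using rho_integrable rho_nonneg C0_compact_integrable[OF C0_compact_power2[OF g]]
        C0_compact_measurable[OF g]
    by (auto simp: square_integrable_def)
  have "\<bar>sqrt (rho x) * v x\<bar> = \<bar>LINT y|lborel. (indicator {..x} y * sqrt (rho y)) * g y\<bar>"
    using LINT_atMost_deriv_compact[OF flux, of x]
    by (simp add: set_lebesgue_integral_def mult.assoc)
  also have "\<dots> \<le> sqrt (LINT y|lborel. (indicator {..x} y * sqrt (rho y))\<^sup>2)
      * sqrt (LINT y|lborel. (g y)\<^sup>2)"
    by (intro LINT_Cauchy_Schwarz square_integrable_indicator_mult square) simp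
  also have "\<dots> \<le> sqrt (LINT y|lborel. rho y) * sqrt (LINT y|lborel. (g y)\<^sup>2)"
  proof (intro mult_right_mono real_sqrt_le_mono integral_mono)
    show "integrable lborel (\<lambda>y. (indicator {..x} y * sqrt (rho y))\<^sup>2)"
      by (intro square_integrable_power2 square_integrable_indicator_mult square) simp
    show "(indicator {..x} y * sqrt (rho y))\<^sup>2 \<le> rho y" for y
      using rho_nonneg[of y] by (simp split: split_indicator)
  qed (auto intro: rho_integrable)
  also have "\<dots> = sqrt (schroedinger_form pot v v')"
    using pot_form[OF v] by (simp add: LINT_rho g_def)
  finally have "\<bar>sqrt (rho x) * v x\<bar> \<le> sqrt (schroedinger_form pot v v')" .
  from power_mono[OF this abs_ge_zero, of 2] show ?thesis
    using pot_form[OF v, symmetric] rho_nonneg by (simp add: power_mult_distrib)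
qed

lemma form_coercive:
  assumes v: "C1_compact v v'" and "t \<ge> 0"
    and ge_1: "\<And>x. 1 \<le> pot x + t * indicator {-R..R} x * rho x"
  shows "(LINT x|lborel. (v x)\<^sup>2) \<le> (1 + t * measure lborel {-R..R}) * schroedinger_form pot v v'"
proof -
  define Q where "Q = schroedinger_form pot v v'"
  have form: "integrable lborel (\<lambda>x. (v' x)\<^sup>2 + pot x * (v x)\<^sup>2)"
    by (intro schroedinger_form_integrable v smooth_continuous smooth_pot)
  have box: "integrable lborel (\<lambda>x. t * Q * indicator {-R..R} x)"
    by (intro integrable_mult_right)
      (auto intro!: integrable_real_indicator simp: emeasure_lborel_Icc_eq)
  have "(v x)\<^sup>2 \<le> ((v' x)\<^sup>2 + pot x * (v x)\<^sup>2) + t * Q * indicator {-R..R} x" for x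
  proof -
    have "(v x)\<^sup>2 \<le> (pot x + t * indicator {-R..R} x * rho x) * (v x)\<^sup>2"
      using mult_right_mono[OF ge_1[of x], of "(v x)\<^sup>2"] by simp
    also have "\<dots> = pot x * (v x)\<^sup>2 + t * indicator {-R..R} x * (rho x * (v x)\<^sup>2)"
      by (simp add: algebra_simps)
    also have "\<dots> \<le> pot x * (v x)\<^sup>2 + t * indicator {-R..R} x * Q"
      unfolding Q_def using \<open>t \<ge> 0\<close>
      by (intro add_left_mono mult_left_mono rho_mult_power2_le_form v) auto
    also have "\<dots> \<le> ((v' x)\<^sup>2 + pot x * (v x)\<^sup>2) + t * Q * indicator {-R..R} x"
      by (simp add: mult_ac)
    finally show ?thesis .
  qed
  hence "(LINT x|lborel. (v x)\<^sup>2) \<le>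
      (LINT x|lborel. ((v' x)\<^sup>2 + pot x * (v x)\<^sup>2) + t * Q * indicator {-R..R} x)"
    by (intro integral_mono Bochner_Integration.integrable_add form box C0_compact_integrable
        C0_compact_power2 C1_compact_C0[OF v])
  also have "\<dots> = (1 + t * measure lborel {-R..R}) * Q"
    using form box by (simp add: Q_def schroedinger_form_def distrib_right mult_ac)
  finally show ?thesis by (simp add: Q_def)
qed

lemma lam_1_pos:
  assumes "filterlim pot at_top at_infinity"
  shows "lam V 1 > 0"
proof -
  have "\<forall>\<^sub>F x in at_infinity. pot x \<ge> 1" using assms by (simp add: filterlim_at_top)
  then obtain R where outside: "\<And>x. \<bar>x\<bar> \<ge> R \<Longrightarrow> pot x \<ge> 1"
    unfolding eventually_at_infinity real_norm_def by blast
  have "compact ((\<lambda>x. (1 - pot x) / rho x) ` {-R..R})"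
    by (intro compact_continuous_image continuous_intros)
      (auto intro: continuous_on_subset smooth_continuous[OF smooth_pot] rho_continuous)
  then obtain t where "t > 0" and inside: "\<forall>x \<in> {-R..R}. \<bar>(1 - pot x) / rho x\<bar> \<le> t"
    by (auto dest!: compact_imp_bounded simp: bounded_pos)
  have ge_1: "1 \<le> pot x + t * indicator {-R..R} x * rho x" for x
  proof (cases "x \<in> {-R..R}")
    case True
    hence "(1 - pot x) / rho x \<le> t" using inside by (meson abs_le_D1)
    thus ?thesis using True rho_pos[of x] by (simp add: pos_divide_le_eq)
  next
    case False
    hence "\<bar>x\<bar> \<ge> R" by auto
    thus ?thesis using outside False by simp
  qed
  define C where "C = 1 + t * measure lborel {-R..R}"
  have "C > 0" using \<open>t > 0\<close> by (simp add: C_def add_pos_nonneg)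
  have "1 / C * (LINT x|lborel. (v x)\<^sup>2) \<le> schroedinger_form pot v v'" if v: "C1_compact v v'"
    for v v'
    using form_coercive[OF v _ ge_1] \<open>t > 0\<close> \<open>C > 0\<close>
    by (simp add: C_def pos_divide_le_eq mult.commute)
  hence "lam V 1 \<ge> ereal (1 / C)"
    using \<open>C > 0\<close> by (intro lam_ge_if_form_ge[where b="\<lambda>_ _. 1"] mu.square_integrable_const) auto
  moreover have "0 < ereal (1 / C)" using \<open>C > 0\<close> by simp
  ultimately show ?thesis by (rule less_le_trans[rotated])
qed

section \<open>The spectral gap above the first max-min value\<close>

lemma eigenpair_riccati:
  assumes F: "eigenpair l F F'" and nonzero: "\<And>x. F' x \<noteq> 0"
    and convex: "\<And>x. deriv (deriv pot) x \<ge> 2 * k\<^sup>2" and "k > 0"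
  shows "convex_riccati (\<lambda>x. sqrt (rho x) * F' x) (\<lambda>x. l * F x / F' x - deriv V x / 2)
    pot (deriv pot) (deriv (deriv pot)) l k"
proof
  fix x
  define p where "p = l * F x / F' x - deriv V x / 2"
  show "sqrt (rho x) * F' x \<noteq> 0" using nonzero by simp
  have "- (deriv V x / 2) * sqrt (rho x) * F' x + (deriv V x * F' x - l * F x) * sqrt (rho x)
      = - p * (sqrt (rho x) * F' x)"
    using nonzero[of x] by (simp add: p_def field_simps)
  thus "((\<lambda>x. sqrt (rho x) * F' x) has_real_derivative
      - (l * F x / F' x - deriv V x / 2) * (sqrt (rho x) * F' x)) (at x)"
    using DERIV_mult[OF sqrt_rho_DERIV eigenpairD(3)[OF F]] by (metis p_def)
  have "((l * F' x) * F' x - (l * F x) * (deriv V x * F' x - l * F x)) / (F' x * F' x)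
      - deriv (deriv V) x / 2 = p\<^sup>2 - pot x + l"
    using nonzero[of x] by (simp add: p_def pot_def field_simps power2_eq_square)
  moreover have "((\<lambda>x. l * F x / F' x - deriv V x / 2) has_real_derivative
      ((l * F' x) * F' x - (l * F x) * (deriv V x * F' x - l * F x)) / (F' x * F' x)
          - deriv (deriv V) x / 2) (at x)"
    by (intro DERIV_diff DERIV_divide DERIV_cmult eigenpairD[OF F] half_deriv_V_DERIV nonzero)
  ultimately show "((\<lambda>x. l * F x / F' x - deriv V x / 2) has_real_derivative
      (l * F x / F' x - deriv V x / 2)\<^sup>2 - pot x + l) (at x)"
    by (simp only: p_def)
next
  have square: "square_integrable (mu V) F'" using mu.C1_SobolevD(4)[OF eigenpairD(1)[OF F]] .
  have "integrable lborel (\<lambda>x. rho x * (F' x)\<^sup>2)"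
    using square_integrable_power2[OF square] square_integrable_measurable[OF square]
    by (simp add: integrable_mu_iff)
  thus "integrable lborel (\<lambda>x. (sqrt (rho x) * F' x)\<^sup>2)"
    by (simp add: power_mult_distrib rho_nonneg)
qed (intro smooth_DERIV smooth_deriv smooth_pot convex \<open>k > 0\<close>)+

lemma form_ge_if_orthogonal_to_ground_state:
  assumes riccati: "convex_riccati u p pot W' W'' l k"
    and v: "C1_compact v v'" and orth: "(LINT x|lborel. u x * v x) = 0"
  shows "(l + 2 * k) * (LINT x|lborel. (v x)\<^sup>2) \<le> schroedinger_form pot v v'"
proof -
  interpret convex_riccati u p pot W' W'' l k by (rule riccati)
  define p' where "p' x = (p x)\<^sup>2 - pot x + l" for x
  have p: "(p has_real_derivative p' x) (at x)" "k \<le> p' x" for x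
    unfolding p'_def by (rule p_DERIV, rule riccati_deriv_ge)
  note continuous = DERIV_continuous_on_UNIV[OF p(1)] smooth_continuous[OF smooth_pot]
  have p'_continuous: "continuous_on UNIV p'" unfolding p'_def
    by (intro continuous_intros continuous)
  have minus_p: "((\<lambda>x. - p x) has_real_derivative - p' x) (at x)" for x by (intro DERIV_minus p)
  have "2 * k * (LINT x|lborel. (v x)\<^sup>2) \<le> (LINT x|lborel. (v' x - (- p x) * v x)\<^sup>2)"
    using ground_state_gap[OF v u_DERIV u_nonzero p(1) p'_continuous k_pos p(2) orth] by simp
  also have "\<dots> = schroedinger_form (\<lambda>x. pot x + - l) v v'"
    unfolding LINT_factorized_form[OF v minus_p continuous_on_minus[OF p'_continuous]]
    by (simp add: p'_def)
  also have "\<dots> = schroedinger_form pot v v' + - l * (LINT x|lborel. (v x)\<^sup>2)"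
    by (rule schroedinger_form_add_const[OF v continuous(2)])
  finally show ?thesis by (simp add: distrib_right)
qed

lemma partner_orthogonal:
  assumes F: "mu.C1_Sobolev F F'" and flux: "C1_compact (\<lambda>x. sqrt (rho x) * v x) (\<lambda>x. rho x * \<phi> x)"
    and orth: "(LINT x|mu V. \<phi> x * F x) = 0" and \<phi>: "test_fun \<phi>"
  shows "(LINT x|lborel. (sqrt (rho x) * F' x) * v x) = 0"
proof -
  note F_continuous = mu.C1_SobolevD(2)[OF F] DERIV_continuous_on_UNIV[OF mu.C1_SobolevD(1)[OF F]]
  have "0 = (LINT x|lborel. F' x * (sqrt (rho x) * v x) + F x * (rho x * \<phi> x))"
    using LINT_deriv_compact[OF C1_compact_mult[OF flux mu.C1_SobolevD(1,2)[OF F]]] by simp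
  also have "\<dots> = (LINT x|lborel. F' x * (sqrt (rho x) * v x))
      + (LINT x|lborel. F x * (rho x * \<phi> x))"
    by (intro Bochner_Integration.integral_add C0_compact_integrable C0_compact_mult_left F_continuous
        C1_compact_C0[OF flux] C1_compact_C0_deriv[OF flux])
  also have "(LINT x|lborel. F x * (rho x * \<phi> x)) = (LINT x|mu V. \<phi> x * F x)"
    using C0_compact_measurable[OF C0_compact_mult_right[OF test_fun_C0_compact[OF \<phi>]
        F_continuous(2)]]
    by (simp add: LINT_mu mult_ac)
  finally show ?thesis using orth by (simp add: mult_ac)
qed

theorem lam_2_ge:
  assumes lam: "lam V 1 = ereal l" and "l > 0" and F: "eigenpair l F F'"
    "(LINT x|mu V. (F x)\<^sup>2) > 0"
    and convex: "\<And>x. deriv (deriv pot) x \<ge> 2 * k\<^sup>2" and "k > 0"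
  shows "lam V 2 \<ge> ereal (l + 2 * k)"
proof (rule lam_ge_if_form_ge[where b="\<lambda>i. if i = 0 then (\<lambda>_. 1) else F"])
  note S = eigenpairD(1)[OF F(1)]
  note riccati = eigenpair_riccati[OF F(1) eigenpair_deriv_nonzero[OF lam \<open>l > 0\<close> F] convex \<open>k > 0\<close>]
  show "square_integrable (mu V) (if i = 0 then (\<lambda>_. 1) else F)" for i :: nat
    using mu.C1_SobolevD(3)[OF S] mu.square_integrable_const by simp
  fix \<phi> v v'
  assume \<phi>: "test_fun \<phi>"
    and orth: "\<forall>i<2::nat. (LINT x|mu V. \<phi> x * (if i = 0 then (\<lambda>_. 1) else F) x) = 0"
    and v: "C1_compact v v'" and flux: "C1_compact (\<lambda>x. sqrt (rho x) * v x) (\<lambda>x. rho x * \<phi> x)"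
  have "(LINT x|mu V. \<phi> x * F x) = 0" using orth[rule_format, of 1] by simp
  from form_ge_if_orthogonal_to_ground_state[OF riccati v partner_orthogonal[OF S flux this \<phi>]]
  show "(l + 2 * k) * (LINT x|lborel. (v x)\<^sup>2) \<le> schroedinger_form pot v v'" .
qed (use \<open>l > 0\<close> \<open>k > 0\<close> in auto)

end

theorem mainTheorem12:
  fixes V :: "real \<Rightarrow> real" and \<kappa> :: real
  assumes "smooth V"
    and "integrable lborel (\<lambda>x. exp (- V x))"
    and "\<exists>l. lam V 1 = ereal l \<and> l \<in> sigma_disc V"
    and "\<kappa> > 0"
    and "\<forall>x. deriv (deriv (\<lambda>y. deriv (deriv V) y / 2 + (deriv V y)\<^sup>2 / 4)) x \<ge> 2 * \<kappa>\<^sup>2"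
  shows "lam V 2 \<ge> lam V 1 + ereal (2 * \<kappa>)"
proof -
  interpret gibbs V by unfold_locales (use assms in auto)
  have convex: "deriv (deriv pot) x \<ge> 2 * \<kappa>\<^sup>2" for x using assms(5) by (simp add: pot_def[abs_def])
  obtain l f where lam: "lam V 1 = ereal l" and f: "eigfun V l f" "(LINT x|mu V. (f x)\<^sup>2) > 0"
    using assms(3) unfolding sigma_disc_def by blast
  obtain F F' where F: "eigenpair l F F'" "(LINT x|mu V. (F x)\<^sup>2) > 0"
    by (rule eigfun_imp_eigenpair[OF f]) (rule that)
  have "filterlim pot at_top at_infinity"
    using convex \<open>\<kappa> > 0\<close> smooth_DERIV smooth_deriv smooth_pot
    by (intro strongly_convex_tendsto_at_infinity[of pot "deriv pot" "deriv (deriv pot)"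
      "2 * \<kappa>\<^sup>2"]) auto
  hence "l > 0" using lam_1_pos lam by simp
  show ?thesis using lam_2_ge[OF lam \<open>l > 0\<close> F convex \<open>\<kappa> > 0\<close>] lam by simp
qed

end
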